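(* Let $\alpha_0,\alpha_1,\alpha_2$ be complex parameters with $\alpha_0+2\alpha_1+\alpha_2=1$. Let $K\in\mathbb{C}(t)[x,y,z,w]$ and consider the polynomial Hamiltonian system with Hamiltonian $K$. Assume: (1) $\deg(K)=6$ with respect to $x,y,z,w$. (2) The system becomes again a polynomial Hamiltonian system in each of the coordinate systems $r_i=(x_i,y_i,z_i,w_i)$, $i=0,2$: $$\begin{aligned} r_0:\;&x_0=-(xy-\alpha_0)y,\ y_0=\tfrac{1}{y},\ z_0=z,\ w_0=w, \\ r_2:\;&x_2=x,\ y_2=y-w,\ z_2=-((z+x)w-\alpha_2)w,\ w_2=\tfrac{1}{w}; \end{aligned}$$ that is, $K$ expressed in the coordinates $r_j$ is a polynomial in $x_j,y_j,z_j,w_j$ over $\mathbb{C}(t)$ for $j=0,2$. (3) In addition, the Hamiltonian system in the coordinates $r_0$ becomes again a polynomial Hamiltonian system in the coordinate system $r_1=(x_1,y_1,z_1,w_1)$: $$r_1:\;x_1=\tfrac{1}{x_0},\ y_1=-\left((y_0+w_0^2-t)x_0+\alpha_1 \right)x_0,\ z_1=z_0-2x_0w_0,\ w_1=w_0;$$ that is, writing $r_0(K)$ for $K$ expressed in the coordinates $r_0$, the function $r_0(K)+x_0$ expressed in the coordinates $r_1$ is a polynomial in $x_1,y_1,z_1,w_1$ over $\mathbb{C}(t)$. Then the system coincides with the Hamiltonian system with Hamiltonian $H$ given by $$\begin{aligned} &(4t+3)(16t^2-12t+9)H=\\ &-12tx^2y^4+12(x+2\alpha_0 t)xy^3+3\{(\alpha_0+14\alpha_1+9\alpha_2)x-4\alpha_0^2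 t\}y^2\\ &+\{-24tx^2-32t^2 x-3\alpha_0(5\alpha_0+14\alpha_1+9\alpha_2)\}y+24x\{x+(4\alpha_0+7\alpha_1+4\alpha_2)t\}\\ &-12tz^2w^4-12\{z-2(\alpha_0+\alpha_2)t\}zw^3+3\{8t^2 z^2-(\alpha_0+6\alpha_1-3\alpha_2)z-4(\alpha_0+\alpha_2)^2 t\}w^2\\ &+\{12tz^2-8(7\alpha_0+8\alpha_1+7\alpha_2)t^2 z+3(5-6\alpha_1-8\alpha_1^2-4\alpha_2)\}w\\ &-3\{(4t^3+1)z+(19\alpha_0+10\alpha_1+7\alpha_2)t\}z\\ &-12x\{-4txwy^3+(4xw+4txw^2-2tzw^2+zw+2t^2 z)y^2\\ &\qquad+(-2xw^2-7tz-4t^2 zw+zw^2+4tzw^3)y+(8tw+5)z\}+24\alpha_0^2 tyw\\ &+12\alpha_1 xw(2w-7y)+6\alpha_2 xyw\{4t(2w-y)-3\}\\ &+6\alpha_0 y\{4t(2x-z)w^2+(x-12t xy+2z)w+4t^2 z\}+24\alpha_0 \alpha_2 tyw. \end{aligned}$$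
   Context: The Hamiltonian system with Hamiltonian $K\in\mathbb{C}(t)[x,y,z,w]$ is $\frac{dx}{dt}=\frac{\partial K}{\partial y}$, $\frac{dy}{dt}=-\frac{\partial K}{\partial x}$, $\frac{dz}{dt}=\frac{\partial K}{\partial w}$, $\frac{dw}{dt}=-\frac{\partial K}{\partial z}$. Two Hamiltonian systems coincide if these differential equations are the same. Coefficients in $\mathbb{C}(t)$ are rational functions of $t$. *)

theory Defs
  imports "HOL-Computational_Algebra.Computational_Algebra"
begin

section \<open>Polynomials in four variables\<close>

text \<open>
  \<open>R[x,y,z,w]\<close> is represented by iterated univariate polynomials, with \<open>x\<close> outermost and \<open>w\<close>
  innermost.
\<close>

type_synonym 'a poly4 = "'a poly poly poly poly"
type_synonym 'a quad = "'a \<times> 'a \<times> 'a \<times> 'a"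

definition coeff4 :: "'a::zero poly4 \<Rightarrow> nat \<Rightarrow> nat \<Rightarrow> nat \<Rightarrow> nat \<Rightarrow> 'a" where
  "coeff4 p i j k l = coeff (coeff (coeff (coeff p i) j) k) l"

definition const4 :: "'a::zero \<Rightarrow> 'a poly4" where
  "const4 c = [:[:[:[:c:]:]:]:]"

definition var_x :: "'a::comm_semiring_1 poly4" where "var_x = [:0, 1:]"
definition var_y :: "'a::comm_semiring_1 poly4" where "var_y = [:[:0, 1:]:]"
definition var_z :: "'a::comm_semiring_1 poly4" where "var_z = [:[:[:0, 1:]:]:]"
definition var_w :: "'a::comm_semiring_1 poly4" where "var_w = [:[:[:[:0, 1:]:]:]:]"

text \<open>
  Total degree in \<open>x,y,z,w\<close>; the zero polynomial gets degree 0. The set below is finite, so \<open>Max\<close>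
  is meaningful (lemma \<open>finite_exponent_sums\<close>).
\<close>

definition total_degree :: "'a::zero poly4 \<Rightarrow> nat" where
  "total_degree p = Max (insert 0 {i + j + k + l | i j k l. coeff4 p i j k l \<noteq> 0})"

lemma finite_exponent_sums: "finite {i + j + k + l | i j k l. coeff4 p i j k l \<noteq> 0}"
proof -
  have fin: "finite {i. coeff q i \<noteq> 0}" for q :: "'b::zero poly"
    by (rule finite_subset[of _ "{..degree q}"]) (auto intro: le_degree)
  let ?S = "SIGMA i:{i. coeff p i \<noteq> 0}. SIGMA j:{j. coeff (coeff p i) j \<noteq> 0}.
     SIGMA k:{k. coeff (coeff (coeff p i) j) k \<noteq> 0}. {l. coeff4 p i j k l \<noteq> 0}"
  have "finite ?S"
    unfolding coeff4_def by (intro finite_SigmaI fin)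
  then have "finite ((\<lambda>(i,j,k,l). i + j + k + l) ` ?S)"
    by (rule finite_imageI)
  moreover have "{i + j + k + l | i j k l. coeff4 p i j k l \<noteq> 0}
      \<subseteq> (\<lambda>(i,j,k,l). i + j + k + l) ` ?S"
  proof
    fix n assume "n \<in> {i + j + k + l | i j k l. coeff4 p i j k l \<noteq> 0}"
    then obtain i j k l where n: "n = i + j + k + l" and c: "coeff4 p i j k l \<noteq> 0"
      by blast
    have "(i, j, k, l) \<in> ?S"
      using c by (auto simp: coeff4_def)
    then show "n \<in> (\<lambda>(i,j,k,l). i + j + k + l) ` ?S"
      unfolding n by (intro image_eqI[of _ _ "(i, j, k, l)"]) simp_all
  qed
  ultimately show ?thesis
    by (rule rev_finite_subset)
qed

definition partial_x :: "'a::field poly4 \<Rightarrow> 'a poly4" where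
  "partial_x = pderiv"
definition partial_y :: "'a::field poly4 \<Rightarrow> 'a poly4" where
  "partial_y = map_poly pderiv"
definition partial_z :: "'a::field poly4 \<Rightarrow> 'a poly4" where
  "partial_z = map_poly (map_poly pderiv)"
definition partial_w :: "'a::field poly4 \<Rightarrow> 'a poly4" where
  "partial_w = map_poly (map_poly (map_poly pderiv))"

text \<open>The right-hand sides \<open>(dx/dt, dy/dt, dz/dt, dw/dt)\<close> of the Hamiltonian system.\<close>

definition hamiltonian_system :: "'a::field poly4 \<Rightarrow> 'a poly4 quad" where
  "hamiltonian_system K = (partial_y K, - partial_x K, partial_w K, - partial_z K)"


section \<open>Rational functions and substitution\<close>

text \<open>\<open>\<complex>(t)\<close> is the type \<^typ>\<open>complex poly fract\<close>.\<close>

definition ct_const :: "complex \<Rightarrow> complex poly fract" where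
  "ct_const a = to_fract [:a:]"

definition ct_t :: "complex poly fract" where
  "ct_t = to_fract [:0, 1:]"

text \<open>Evaluation along a coefficient map \<open>h\<close>, which must satisfy \<open>h 0 = 0\<close>.\<close>

definition eval_hom :: "('a::zero \<Rightarrow> 'b::comm_semiring_0) \<Rightarrow> 'a poly \<Rightarrow> 'b \<Rightarrow> 'b" where
  "eval_hom h p a = poly (map_poly h p) a"

definition rat_const :: "'a::field \<Rightarrow> 'a poly4 fract" where
  "rat_const c = to_fract (const4 c)"

fun subst4 :: "'a::field poly4 \<Rightarrow> 'a poly4 fract quad \<Rightarrow> 'a poly4 fract" where
  "subst4 p (a, b, c, d) =
     eval_hom (\<lambda>q. eval_hom (\<lambda>r. eval_hom (\<lambda>s. eval_hom rat_const s d) r c) q b) p a"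

text \<open>
  A coordinate change \<open>\<rho>\<close> gives the new coordinates as rational functions of the old ones
  \<open>(x,y,z,w)\<close>. The polynomial \<open>P\<close>, in the new coordinates, is the expression of \<open>K\<close> in these
  coordinates iff \<open>K(x,y,z,w) = P(\<rho>(x,y,z,w))\<close> as rational functions. The names of the four
  variables are reused for old and new coordinates; thus \<open>r\<^sub>0(K) + x\<^sub>0\<close> is \<open>K0 + var_x\<close> whenever
  \<open>expressed_in (r0 \<alpha>0) K K0\<close>.
\<close>

definition expressed_in ::
    "('a::field poly4 fract quad \<Rightarrow> 'a poly4 fract quad) \<Rightarrow> 'a poly4 \<Rightarrow> 'a poly4 \<Rightarrow> bool" where
  "expressed_in \<rho> K P \<longleftrightarrow>
     to_fract K =
       subst4 P (\<rho> (to_fract var_x, to_fract var_y, to_fract var_z, to_fract var_w))"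


section \<open>The coordinate systems\<close>

fun coord_r0 :: "'a::field \<Rightarrow> 'a quad \<Rightarrow> 'a quad" where
  "coord_r0 \<alpha>0 (x, y, z, w) = (- (x * y - \<alpha>0) * y, 1 / y, z, w)"

text \<open>Here the arguments are the coordinates of the system \<open>r\<^sub>0\<close>.\<close>

fun coord_r1 :: "'a::field \<Rightarrow> 'a \<Rightarrow> 'a quad \<Rightarrow> 'a quad" where
  "coord_r1 t \<alpha>1 (x, y, z, w) =
     (1 / x, - ((y + w^2 - t) * x + \<alpha>1) * x, z - 2 * x * w, w)"

fun coord_r2 :: "'a::field \<Rightarrow> 'a quad \<Rightarrow> 'a quad" where
  "coord_r2 \<alpha>2 (x, y, z, w) = (x, y - w, - ((z + x) * w - \<alpha>2) * w, 1 / w)"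

definition r0 ::
    "complex \<Rightarrow> complex poly fract poly4 fract quad \<Rightarrow> complex poly fract poly4 fract quad" where
  "r0 \<alpha>0 = coord_r0 (rat_const (ct_const \<alpha>0))"
definition r1 ::
    "complex \<Rightarrow> complex poly fract poly4 fract quad \<Rightarrow> complex poly fract poly4 fract quad" where
  "r1 \<alpha>1 = coord_r1 (rat_const ct_t) (rat_const (ct_const \<alpha>1))"
definition r2 ::
    "complex \<Rightarrow> complex poly fract poly4 fract quad \<Rightarrow> complex poly fract poly4 fract quad" where
  "r2 \<alpha>2 = coord_r2 (rat_const (ct_const \<alpha>2))"


section \<open>The Hamiltonian\<close>

text \<open>The polynomial \<open>(4t+3)(16t\<^sup>2-12t+9)H\<close>, as a formula over an arbitrary commutative ring.\<close>

definition H_numerator ::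
    "'a::comm_ring_1 \<Rightarrow> 'a \<Rightarrow> 'a \<Rightarrow> 'a \<Rightarrow> 'a \<Rightarrow> 'a \<Rightarrow> 'a \<Rightarrow> 'a \<Rightarrow> 'a" where
  "H_numerator t \<alpha>0 \<alpha>1 \<alpha>2 x y z w =
     - 12*t*x^2*y^4 + 12*(x + 2*\<alpha>0*t)*x*y^3
     + 3*((\<alpha>0 + 14*\<alpha>1 + 9*\<alpha>2)*x - 4*\<alpha>0^2*t)*y^2
     + (- 24*t*x^2 - 32*t^2*x - 3*\<alpha>0*(5*\<alpha>0 + 14*\<alpha>1 + 9*\<alpha>2))*y
     + 24*x*(x + (4*\<alpha>0 + 7*\<alpha>1 + 4*\<alpha>2)*t)
     - 12*t*z^2*w^4 - 12*(z - 2*(\<alpha>0 + \<alpha>2)*t)*z*w^3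
     + 3*(8*t^2*z^2 - (\<alpha>0 + 6*\<alpha>1 - 3*\<alpha>2)*z - 4*(\<alpha>0 + \<alpha>2)^2*t)*w^2
     + (12*t*z^2 - 8*(7*\<alpha>0 + 8*\<alpha>1 + 7*\<alpha>2)*t^2*z + 3*(5 - 6*\<alpha>1 - 8*\<alpha>1^2 - 4*\<alpha>2))*w
     - 3*((4*t^3 + 1)*z + (19*\<alpha>0 + 10*\<alpha>1 + 7*\<alpha>2)*t)*z
     - 12*x*(- 4*t*x*w*y^3
             + (4*x*w + 4*t*x*w^2 - 2*t*z*w^2 + z*w + 2*t^2*z)*y^2
             + (- 2*x*w^2 - 7*t*z - 4*t^2*z*w + z*w^2 + 4*t*z*w^3)*y
             + (8*t*w + 5)*z)
     + 24*\<alpha>0^2*t*y*w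
     + 12*\<alpha>1*x*w*(2*w - 7*y) + 6*\<alpha>2*x*y*w*(4*t*(2*w - y) - 3)
     + 6*\<alpha>0*y*(4*t*(2*x - z)*w^2 + (x - 12*t*x*y + 2*z)*w + 4*t^2*z)
     + 24*\<alpha>0*\<alpha>2*t*y*w"

definition H :: "complex \<Rightarrow> complex \<Rightarrow> complex \<Rightarrow> complex poly fract poly4" where
  "H \<alpha>0 \<alpha>1 \<alpha>2 =
     const4 (1 / ((4 * ct_t + 3) * (16 * ct_t^2 - 12 * ct_t + 9))) *
     H_numerator (const4 ct_t)
       (const4 (ct_const \<alpha>0)) (const4 (ct_const \<alpha>1)) (const4 (ct_const \<alpha>2))
       var_x var_y var_z var_w"

end

theory Submission
  imports Defs
begin

text \<open>
  The coordinate systems are charts of one algebraic variety, and the hypotheses say that \<open>K\<close>, or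
  \<open>K + x\<^sub>0\<close> in the chart \<open>r\<^sub>1\<close>, has no pole along the divisor that a chart adds. Each of these
  conditions is a system of linear equations over \<open>\<complex>(t)\<close> for the coefficients of \<open>K\<close>, and the
  theorem says that all of them together determine \<open>K\<close>, of degree at most 6, up to an additive
  constant. The proof solves the system; what makes this feasible is the grading by the degree in
  \<open>x, z\<close>.

  Let \<open>N\<close> be the degree of \<open>K\<close> in \<open>x, z\<close> and \<open>\<Sum>\<^sub>i C\<^sub>i(y, w) x\<^sup>i z\<^bsup>N-i\<^esup>\<close> its top part. In
  the chart \<open>r\<^sub>1\<close> the coordinates \<open>x\<close> and \<open>z\<close> have a pole along the new divisor \<open>x\<^sub>1 = 0\<close>, while \<open>y\<close>
  tends to \<open>1/c\<close> with \<open>c = t - w\<^sup>2\<close>. So \<open>K\<close> can only be regular there if its top part cancels: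
  \<open>\<Sum>\<^sub>i (- c\<^sup>2)\<^sup>i C\<^sub>i(1/c, w) Z\<^bsup>N-i\<^esup> = C\<^sub>0 (Z - 2 w)\<^sup>N\<close> (\<open>top_coefficients_r1\<close>). For \<open>N \<ge> 3\<close>
  the degrees in \<open>w\<close> on the two sides do not fit unless \<open>C\<^sub>0 = 0\<close>, and then the \<open>C\<^sub>i\<close> vanish on the
  cubic curve \<open>c y = 1\<close>. As their degree is at most \<open>6 - N\<close>, this leaves only \<open>N = 3\<close> with
  multiples of the equation of the curve (\<open>top_coefficients\<close>), and this case is excluded by the
  first-order behaviour in \<open>r\<^sub>2\<close> and \<open>r\<^sub>1\<close> (\<open>coeff4_K_eq_0_of_degree_xz_gt_2\<close>). So \<open>K\<close> is quadratic
  in \<open>x, z\<close>.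

  A quadratic \<open>K\<close> that is regular in \<open>r\<^sub>0\<close> has a normal form with 14 polynomials in \<open>w\<close> as
  coefficients (\<open>K_normal_form\<close>). For it the regularity in \<open>r\<^sub>1\<close> implies three identities between
  these polynomials (\<open>r1_equations_pointwise\<close>), and the regularity in \<open>r\<^sub>2\<close> bounds the degree in \<open>w\<close>
  of five combinations of them. Comparison of coefficients gives linear equations that can be
  solved one after the other with pivots that do not involve the parameters. They express
  everything, except the additive constant, by one unknown \<open>q\<close>, where \<open>24 q\<close> is the coefficient of
  \<open>x\<^sup>2\<close>. The last equation is the only inhomogeneous one, because of the term \<open>x\<^sub>0\<close> in the third
  hypothesis; it reads \<open>q (64 t\<^sup>3 + 27) (\<alpha>\<^sub>0 + 2 \<alpha>\<^sub>1 + \<alpha>\<^sub>2) = 1\<close>. This is where the normalization of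
  the parameters enters, and where the denominator \<open>(4 t + 3) (16 t\<^sup>2 - 12 t + 9) = 64 t\<^sup>3 + 27\<close> of \<open>H\<close>
  comes from (\<open>K_determined\<close>).
\<close>

section \<open>Coordinate changes as identities between polynomial functions\<close>

instance fract :: ("{idom,ring_char_0}") ring_char_0
proof
  show "inj (of_nat :: nat \<Rightarrow> 'a fract)"
    by (auto simp: inj_on_def of_nat_fract eq_fract)
qed

instance fract :: ("{idom,ring_char_0}") field_char_0 ..

definition ev :: "'a::comm_ring_1 poly4 \<Rightarrow> 'a \<Rightarrow> 'a \<Rightarrow> 'a \<Rightarrow> 'a \<Rightarrow> 'a" where
  "ev p x y z w = poly (poly (poly (poly p [:[:[:x:]:]:]) [:[:y:]:]) [:z:]) w"

lemma ev_simps [simp]: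
  "ev (p + q) x y z w = ev p x y z w + ev q x y z w"
  "ev (p - q) x y z w = ev p x y z w - ev q x y z w"
  "ev (- p) x y z w = - ev p x y z w"
  "ev (p * q) x y z w = ev p x y z w * ev q x y z w"
  "ev (p ^ n) x y z w = ev p x y z w ^ n"
  "ev 0 x y z w = 0" "ev 1 x y z w = 1" "ev (numeral k) x y z w = numeral k"
  "ev (const4 c) x y z w = c"
  "ev var_x x y z w = x" "ev var_y x y z w = y" "ev var_z x y z w = z" "ev var_w x y z w = w"
  by (simp_all add: ev_def const4_def var_x_def var_y_def var_z_def var_w_def poly_power)

lemma eval_hom_pCons:
  "h 0 = 0 \<Longrightarrow> eval_hom h (pCons a p) b = h a + b * eval_hom h p b"
  by (simp add: eval_hom_def map_poly_pCons)

lemma eval_hom_0 [simp]: "eval_hom h 0 b = 0"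
  by (simp add: eval_hom_def)

lemma eval_hom_poly: "eval_hom (\<lambda>s. poly s w) r z = poly (poly r [:z:]) w"
  by (induction r) (simp_all add: eval_hom_pCons)

lemma eval_hom_poly2:
  "eval_hom (\<lambda>r. poly (poly r [:z:]) w) q y = poly (poly (poly q [:[:y:]:]) [:z:]) w"
  by (induction q) (simp_all add: eval_hom_pCons)

lemma eval_hom_poly3:
  "eval_hom (\<lambda>q. poly (poly (poly q [:[:y:]:]) [:z:]) w) p x = ev p x y z w"
  by (induction p) (simp_all add: eval_hom_pCons ev_def)

text \<open>
  The rational function \<open>q\<close> belongs to the local ring of the point \<open>a\<close> and takes the value \<open>v\<close>
  there. Values at points turn \<^const>\<open>expressed_in\<close>, an identity in a function field, into
  pointwise identities, into which other coordinates can be substituted.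
\<close>

definition has_value :: "'a::field poly4 fract \<Rightarrow> 'a quad \<Rightarrow> 'a \<Rightarrow> bool" where
  "has_value q a v \<longleftrightarrow> (case a of (x, y, z, w) \<Rightarrow>
     \<exists>n d. q = Fract n d \<and> ev d x y z w \<noteq> 0 \<and> v = ev n x y z w / ev d x y z w)"

lemma has_valueI:
  "q = Fract n d \<Longrightarrow> ev d x y z w \<noteq> 0 \<Longrightarrow> v = ev n x y z w / ev d x y z w
    \<Longrightarrow> has_value q (x, y, z, w) v"
  unfolding has_value_def by auto

lemma has_value_unique:
  assumes "has_value q a v" "has_value q a v'"
  shows "v = v'"
proof -
  obtain x y z w where a: "a = (x, y, z, w)" by (metis prod_cases4)
  obtain n d n' d' where nd: "Fract n d = Fract n' d'" "ev d x y z w \<noteq> 0" "ev d' x y z w \<noteq> 0"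
    and v: "v = ev n x y z w / ev d x y z w" "v' = ev n' x y z w / ev d' x y z w"
    using assms unfolding has_value_def a by auto
  have "d \<noteq> 0" "d' \<noteq> 0" using nd by auto
  hence "n * d' = n' * d" using nd(1) by (simp add: eq_fract)
  hence "ev n x y z w * ev d' x y z w = ev n' x y z w * ev d x y z w"
    by (metis ev_simps(4))
  thus ?thesis using nd(2,3) unfolding v by (simp add: frac_eq_eq)
qed

lemma has_value_to_fract: "has_value (to_fract p) (x, y, z, w) (ev p x y z w)"
  by (rule has_valueI[of _ p 1]) (simp_all add: to_fract_def)

lemma has_value_add:
  assumes "has_value q a v" "has_value r a u"
  shows "has_value (q + r) a (v + u)"
proof -
  obtain x y z w where a: "a = (x, y, z, w)" by (metis prod_cases4)
  obtain n d n' d' where nd: "q = Fract n d" "r = Fract n' d'" "ev d x y z w \<noteq> 0" "ev d' x y z w \<noteq> 0"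
    and v: "v = ev n x y z w / ev d x y z w" "u = ev n' x y z w / ev d' x y z w"
    using assms unfolding has_value_def a by auto
  have "d \<noteq> 0" "d' \<noteq> 0" using nd by auto
  then show ?thesis
    unfolding a nd(1,2) using nd(3,4)
    by (intro has_valueI[of _ "n * d' + n' * d" "d * d'"]) (simp_all add: v add_frac_eq)
qed

lemma has_value_mult:
  assumes "has_value q a v" "has_value r a u"
  shows "has_value (q * r) a (v * u)"
proof -
  obtain x y z w where a: "a = (x, y, z, w)" by (metis prod_cases4)
  obtain n d n' d' where nd: "q = Fract n d" "r = Fract n' d'" "ev d x y z w \<noteq> 0" "ev d' x y z w \<noteq> 0"
    and v: "v = ev n x y z w / ev d x y z w" "u = ev n' x y z w / ev d' x y z w"
    using assms unfolding has_value_def a by auto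
  then show ?thesis
    unfolding a nd(1,2) by (intro has_valueI[of _ "n * n'" "d * d'"]) simp_all
qed

lemma has_value_uminus: "has_value q a v \<Longrightarrow> has_value (- q) a (- v)"
proof -
  assume "has_value q a v"
  moreover have "has_value (to_fract (- 1)) a (- 1)"
  proof -
    obtain x y z w where a: "a = (x, y, z, w)" by (metis prod_cases4)
    have "ev (- 1) x y z w = (- 1 :: 'a)" by simp
    then show ?thesis using has_value_to_fract[of "- 1 :: 'a poly4" x y z w] unfolding a by metis
  qed
  ultimately show ?thesis
    using has_value_mult[of "to_fract (- 1)" a "- 1" q v] by simp
qed

lemma has_value_diff:
  "has_value q a v \<Longrightarrow> has_value r a u \<Longrightarrow> has_value (q - r) a (v - u)"
  using has_value_add[OF _ has_value_uminus, of q a v r u] by simp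

lemma has_value_inverse:
  assumes "has_value q a v" "v \<noteq> 0"
  shows "has_value (1 / q) a (1 / v)"
proof -
  obtain x y z w where a: "a = (x, y, z, w)" by (metis prod_cases4)
  obtain n d where nd: "q = Fract n d" "ev d x y z w \<noteq> 0" and v: "v = ev n x y z w / ev d x y z w"
    using assms unfolding has_value_def a by auto
  then have "ev n x y z w \<noteq> 0" using assms(2) by auto
  then show ?thesis
    unfolding a nd(1) by (intro has_valueI[of _ d n]) (simp_all add: v One_fract_def)
qed

lemma has_value_power: "has_value q a v \<Longrightarrow> has_value (q ^ n) a (v ^ n)"
proof (induction n)
  case 0
  then show ?case using has_value_to_fract[of 1] by (cases a) simp
qed (simp add: has_value_mult)

lemma has_value_rat_const: "has_value (rat_const c) a c"
  using has_value_to_fract[of "const4 c"] by (cases a) (simp add: rat_const_def)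

lemma to_fract_numeral: "to_fract (numeral k) = (numeral k :: 'a::idom fract)"
proof -
  have "to_fract (of_nat n) = (of_nat n :: 'a fract)" for n
    by (induction n) simp_all
  from this[of "numeral k"] show ?thesis by simp
qed

lemma has_value_numeral: "has_value (numeral k) a (numeral k)"
  using has_value_to_fract[of "numeral k"] by (cases a) (simp add: to_fract_numeral)

lemmas has_value_intros = has_value_add has_value_mult has_value_uminus has_value_diff
  has_value_inverse has_value_power has_value_rat_const has_value_numeral

lemma has_value_eval_hom:
  assumes "h 0 = 0" "g 0 = 0" "\<And>b. has_value (h b) a (g b)" "has_value f a v"
  shows "has_value (eval_hom h p f) a (eval_hom g p v)"
proof (induction p)
  case 0
  show ?case using has_value_to_fract[of 0] by (cases a) simp
qed (simp add: eval_hom_pCons assms has_value_intros)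

text \<open>
  The local ring is closed under the ring operations, so substitution into a polynomial stays in
  it, and the residue map commutes with it, one variable after the other.
\<close>

lemma has_value_subst4:
  assumes "has_value f1 a v1" "has_value f2 a v2" "has_value f3 a v3" "has_value f4 a v4"
  shows "has_value (subst4 P (f1, f2, f3, f4)) a (ev P v1 v2 v3 v4)"
proof -
  have 1: "has_value (eval_hom rat_const s f4) a (poly s v4)" for s
  proof -
    have "has_value (eval_hom rat_const s f4) a (eval_hom (\<lambda>c. c) s v4)"
      by (rule has_value_eval_hom[OF _ _ has_value_rat_const assms(4)])
        (simp_all add: rat_const_def const4_def)
    then show ?thesis by (simp add: eval_hom_def)
  qed
  have 2: "has_value (eval_hom (\<lambda>s. eval_hom rat_const s f4) r f3) a (poly (poly r [:v3:]) v4)" for r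
    unfolding eval_hom_poly[symmetric] by (rule has_value_eval_hom) (auto simp: 1 assms)
  have 3: "has_value (eval_hom (\<lambda>r. eval_hom (\<lambda>s. eval_hom rat_const s f4) r f3) q f2) a
      (poly (poly (poly q [:[:v2:]:]) [:v3:]) v4)" for q
    unfolding eval_hom_poly2[symmetric] by (rule has_value_eval_hom) (auto simp: 2 assms)
  show ?thesis
    unfolding eval_hom_poly3[symmetric] subst4.simps
    by (rule has_value_eval_hom) (auto simp: 3 assms)
qed

lemma expressed_in_ev:
  assumes "expressed_in \<rho> K P"
    and "\<rho> (to_fract var_x, to_fract var_y, to_fract var_z, to_fract var_w) = (f1, f2, f3, f4)"
    and "has_value f1 (x, y, z, w) v1" "has_value f2 (x, y, z, w) v2"
      "has_value f3 (x, y, z, w) v3" "has_value f4 (x, y, z, w) v4"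
  shows "ev K x y z w = ev P v1 v2 v3 v4"
proof -
  have "to_fract K = subst4 P (f1, f2, f3, f4)"
    using assms(1,2) unfolding expressed_in_def by simp
  then show ?thesis
    using has_value_unique has_value_to_fract has_value_subst4[OF assms(3-6)] by metis
qed

lemma has_value_vars:
  "has_value (to_fract var_x) (x, y, z, w) x" "has_value (to_fract var_y) (x, y, z, w) y"
  "has_value (to_fract var_z) (x, y, z, w) z" "has_value (to_fract var_w) (x, y, z, w) w"
  using has_value_to_fract[of var_x x y z w] has_value_to_fract[of var_y x y z w]
    has_value_to_fract[of var_z x y z w] has_value_to_fract[of var_w x y z w] by simp_all

text \<open>
  The next three lemmas read the coordinate changes backwards: the old coordinates are expressed in
  the new ones. So \<open>K\<close>, composed with a map that has a pole along a coordinate hyperplane of the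
  new chart, is a polynomial; the absence of the pole is what restricts \<open>K\<close>.
\<close>

lemma expressed_in_r0:
  assumes "expressed_in (coord_r0 (rat_const a)) K P" "y \<noteq> 0"
  shows "ev K ((a - x * y) * y) (1 / y) z w = ev P x y z w"
proof -
  have "ev K X Y z w = ev P (- (X * Y - a) * Y) (1 / Y) z w" if "Y \<noteq> 0" for X Y
    by (rule expressed_in_ev[OF assms(1) coord_r0.simps]) (intro has_value_intros has_value_vars that)+
  from this[of "1 / y" "(a - x * y) * y"] show ?thesis using assms(2) by simp
qed

lemma expressed_in_r1:
  assumes "expressed_in (coord_r1 (rat_const t) (rat_const a)) K P" "x \<noteq> 0"
  shows "ev K (1 / x) (t - w\<^sup>2 - (x * y + a) * x) (z + 2 * w / x) w = ev P x y z w"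
proof -
  have "ev K X Y Z w = ev P (1 / X) (- ((Y + w\<^sup>2 - t) * X + a) * X) (Z - 2 * X * w) w"
    if "X \<noteq> 0" for X Y Z
    by (rule expressed_in_ev[OF assms(1) coord_r1.simps]) (intro has_value_intros has_value_vars that)+
  from this[of "1 / x" "t - w\<^sup>2 - (x * y + a) * x" "z + 2 * w / x"] show ?thesis
    using assms(2) by simp
qed

lemma expressed_in_r2:
  assumes "expressed_in (coord_r2 (rat_const a)) K P" "w \<noteq> 0"
  shows "ev K x (y + 1 / w) ((a - z * w) * w - x) (1 / w) = ev P x y z w"
proof -
  have "ev K x Y Z W = ev P x (Y - W) (- ((Z + x) * W - a) * W) (1 / W)"
    if "W \<noteq> 0" for Y Z W
    by (rule expressed_in_ev[OF assms(1) coord_r2.simps]) (intro has_value_intros has_value_vars that)+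
  from this[of "1 / w" "y + 1 / w" "(a - z * w) * w - x"] show ?thesis
    using assms(2) by simp
qed

section \<open>Polynomial functions over an infinite field\<close>

lemma poly_eqI_cofinite:
  fixes p q :: "'a::{idom,ring_char_0} poly"
  assumes "finite S" "\<And>x. x \<notin> S \<Longrightarrow> poly p x = poly q x"
  shows "p = q"
proof (rule ccontr)
  assume "p \<noteq> q"
  then have "finite {x. poly (p - q) x = 0}" by (intro poly_roots_finite) simp
  moreover have "UNIV \<subseteq> S \<union> {x. poly (p - q) x = 0}" using assms(2) by auto
  ultimately show False
    using assms(1) infinite_UNIV_char_0 finite_subset by blast
qed

lemma poly2_eqI_cofinite:
  fixes P Q :: "'a::{idom,ring_char_0} poly poly"
  assumes "finite S" "\<And>x z. x \<notin> S \<Longrightarrow> poly (poly P [:z:]) x = poly (poly Q [:z:]) x"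
  shows "P = Q"
proof (rule ccontr)
  assume "P \<noteq> Q"
  then have "finite {x. poly (P - Q) x = 0}" by (intro poly_roots_finite) simp
  moreover have "poly P [:z:] = poly Q [:z:]" for z
    by (rule poly_eqI_cofinite[OF assms])
  then have "range (\<lambda>z. [:z:]) \<subseteq> {x. poly (P - Q) x = 0}" by auto
  ultimately have "finite (range (\<lambda>z::'a. [:z:]))" by (rule finite_subset[rotated])
  then have "finite (UNIV :: 'a set)" by (rule finite_imageD) (simp add: inj_on_def)
  then show False using infinite_UNIV_char_0 by blast
qed

text \<open>
  Polynomiality as a property of functions: the polynomials \<open>K0\<close>, \<open>K1\<close>, \<open>K2\<close> enter the arguments
  below only through the fact that their values along certain curves and surfaces are polynomial.
\<close>

definition polyfun2 :: "('a::comm_ring_1 \<Rightarrow> 'a \<Rightarrow> 'a) \<Rightarrow> bool" where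
  "polyfun2 f \<longleftrightarrow> (\<exists>P. \<forall>x z. f x z = poly (poly P [:z:]) x)"

lemma polyfun2I: "(\<And>x z. f x z = poly (poly P [:z:]) x) \<Longrightarrow> polyfun2 f"
  unfolding polyfun2_def by blast

lemma polyfun2_const: "polyfun2 (\<lambda>x z. a)"
  by (rule polyfun2I[of _ "[:[:a:]:]"]) simp

lemma polyfun2_fst: "polyfun2 (\<lambda>x z. x)"
  by (rule polyfun2I[of _ "[:[:0, 1:]:]"]) simp

lemma polyfun2_snd: "polyfun2 (\<lambda>x z. z)"
  by (rule polyfun2I[of _ "[:0, 1:]"]) simp

lemma polyfun2_add:
  assumes "polyfun2 f" "polyfun2 g" shows "polyfun2 (\<lambda>x z. f x z + g x z)"
proof -
  obtain P Q where "\<And>x z. f x z = poly (poly P [:z:]) x" "\<And>x z. g x z = poly (poly Q [:z:]) x"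
    using assms unfolding polyfun2_def by blast
  then show ?thesis by (intro polyfun2I[of _ "P + Q"]) simp
qed

lemma polyfun2_mult:
  assumes "polyfun2 f" "polyfun2 g" shows "polyfun2 (\<lambda>x z. f x z * g x z)"
proof -
  obtain P Q where "\<And>x z. f x z = poly (poly P [:z:]) x" "\<And>x z. g x z = poly (poly Q [:z:]) x"
    using assms unfolding polyfun2_def by blast
  then show ?thesis by (intro polyfun2I[of _ "P * Q"]) simp
qed

lemma polyfun2_uminus:
  assumes "polyfun2 f" shows "polyfun2 (\<lambda>x z. - f x z)"
  using polyfun2_mult[OF polyfun2_const[of "- 1"] assms] by simp

lemma polyfun2_diff:
  assumes "polyfun2 f" "polyfun2 g" shows "polyfun2 (\<lambda>x z. f x z - g x z)"
  using polyfun2_add[OF assms(1) polyfun2_uminus[OF assms(2)]] by simp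

lemma polyfun2_power: "polyfun2 f \<Longrightarrow> polyfun2 (\<lambda>x z. f x z ^ n)"
  by (induction n) (simp_all add: polyfun2_const polyfun2_mult)

lemma polyfun2_sum: "(\<And>i. i \<in> A \<Longrightarrow> polyfun2 (f i)) \<Longrightarrow> polyfun2 (\<lambda>x z. \<Sum>i\<in>A. f i x z)"
  by (induction A rule: infinite_finite_induct) (simp_all add: polyfun2_const polyfun2_add)

lemma polyfun2_poly:
  "polyfun2 f \<Longrightarrow> polyfun2 (\<lambda>x z. poly p (f x z))"
  by (induction p) (simp_all add: polyfun2_const polyfun2_add polyfun2_mult)

lemma ev_pCons: "ev (pCons q p) x y z w = poly (poly (poly q [:[:y:]:]) [:z:]) w + x * ev p x y z w"
  by (simp add: ev_def)

lemma polyfun2_ev: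
  assumes "polyfun2 f" "polyfun2 g" "polyfun2 h" "polyfun2 k"
  shows "polyfun2 (\<lambda>a b. ev p (f a b) (g a b) (h a b) (k a b))"
proof -
  have 1: "polyfun2 (\<lambda>a b. poly (poly r [:h a b:]) (k a b))" for r
    by (induction r) (simp_all add: polyfun2_const polyfun2_add polyfun2_mult polyfun2_poly assms)
  have 2: "polyfun2 (\<lambda>a b. poly (poly (poly q [:[:g a b:]:]) [:h a b:]) (k a b))" for q
    by (induction q) (simp_all add: polyfun2_const polyfun2_add polyfun2_mult 1 assms)
  show ?thesis
    by (induction p) (simp_all add: polyfun2_const polyfun2_add polyfun2_mult 2 assms ev_pCons)
qed

lemmas polyfun2_intros = polyfun2_const polyfun2_fst polyfun2_snd polyfun2_add polyfun2_mult
  polyfun2_uminus polyfun2_diff polyfun2_power polyfun2_sum polyfun2_ev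

definition polyfun :: "('a::comm_ring_1 \<Rightarrow> 'a) \<Rightarrow> bool" where
  "polyfun f \<longleftrightarrow> (\<exists>P. \<forall>x. f x = poly P x)"

lemma polyfun_if_polyfun2: "polyfun2 (\<lambda>x z. f x) \<Longrightarrow> polyfun f"
  unfolding polyfun_def polyfun2_def by metis

lemma poly_vanishing_order:
  fixes P :: "'a::{idom,ring_char_0} poly"
  assumes "finite S" "\<And>x. x \<notin> S \<Longrightarrow> poly P x = x ^ N * f x" "polyfun f" "j < N"
  shows "coeff P j = 0"
proof -
  obtain Q where Q: "\<And>x. f x = poly Q x" using assms(3) unfolding polyfun_def by blast
  have "P = monom 1 N * Q"
    by (rule poly_eqI_cofinite[OF assms(1)]) (simp add: assms(2) Q poly_monom)
  then show ?thesis using assms(4) by (simp add: coeff_monom_mult)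
qed

text \<open>
  In the coordinate \<open>p = 1/w\<close> at infinity a polynomial of degree \<open>n\<close> in \<open>w\<close> has a pole of order
  exactly \<open>n\<close>: the constant coefficient of its reflected polynomial is its leading coefficient.
\<close>

lemma degree_le_pole_order:
  fixes f :: "'a::field_char_0 poly"
  assumes "\<And>p. p \<noteq> 0 \<Longrightarrow> p ^ m * poly f (1 / p) = g p" "polyfun g" "m < d"
  shows "coeff f d = 0"
proof (rule ccontr)
  assume "coeff f d \<noteq> 0"
  then have d: "m < degree f" using assms(3) le_degree[of f d] by simp
  define n where "n = degree f"
  obtain Q where Q: "\<And>p. g p = poly Q p" using assms(2) unfolding polyfun_def by blast
  have "poly (reflect_poly f) p = p ^ (n - m) * g p" if "p \<notin> {0}" for p
  proof -
    have "p ^ (n - m) * (p ^ m * poly f (1 / p)) = poly (reflect_poly f) p"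
      using that d by (simp add: poly_reflect_poly_nz n_def power_add[symmetric] inverse_eq_divide
          mult.assoc[symmetric])
    then show ?thesis using assms(1)[of p] that by simp
  qed
  then have "coeff (reflect_poly f) 0 = 0"
    by (rule poly_vanishing_order[rotated]) (use assms(2) d in \<open>auto simp: n_def\<close>)
  then show False using d by auto
qed

text \<open>
  The substitution \<open>e = x z\<close> blows up the point \<open>(0, 0)\<close>. If \<open>f(x, x z)\<close> is divisible by \<open>x\<^sup>N\<close>, then
  the coefficient of \<open>e\<^sup>i\<close> in \<open>f(x, e)\<close>, which is multiplied by \<open>x\<^sup>i\<close>, must itself be divisible by
  \<open>x\<^bsup>N-i\<^esup>\<close>, and so it vanishes at \<open>x = 0\<close> for \<open>i < N\<close>.
\<close>

lemma blow_up_vanishing: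
  fixes f g :: "'a::{idom,ring_char_0} \<Rightarrow> 'a \<Rightarrow> 'a"
  assumes "polyfun2 f" "polyfun2 g" "finite S"
    and fg: "\<And>x z. x \<notin> S \<Longrightarrow> f x (x * z) = x ^ N * g x z"
  shows "\<exists>R. \<forall>e. f 0 e = e ^ N * poly R e"
proof -
  obtain P where P: "\<And>x z. f x z = poly (poly P [:z:]) x"
    using assms(1) unfolding polyfun2_def by blast
  obtain Q where Q: "\<And>x z. g x z = poly (poly Q [:z:]) x"
    using assms(2) unfolding polyfun2_def by blast
  have "P \<circ>\<^sub>p [:0, [:0, 1:]:] = smult (monom 1 N) Q"
  proof (rule poly2_eqI_cofinite[OF assms(3)])
    fix x z assume x: "x \<notin> S"
    have "poly (poly P [:x * z:]) x = poly (poly P (smult z [:0, 1:])) x"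
      by (induction P) auto
    then show "poly (poly (P \<circ>\<^sub>p [:0, [:0, 1:]:]) [:z:]) x = poly (poly (smult (monom 1 N) Q) [:z:]) x"
      using fg[OF x, of z] by (simp add: P Q poly_pcompose poly_monom)
  qed
  then have c: "[:0, 1:] ^ e * coeff P e = monom 1 N * coeff Q e" for e
    by (metis coeff_pcompose_linear coeff_smult)
  have "poly (coeff P e) 0 = 0" if "e < N" for e
  proof -
    have "monom 1 e * coeff P e = monom 1 e * (monom 1 (N - e) * coeff Q e)"
      using c[of e] that by (simp add: mult.assoc[symmetric] monom_altdef power_add[symmetric])
    then have "coeff P e = monom 1 (N - e) * coeff Q e"
      by (simp only: mult_cancel_left monom_eq_0_iff) simp
    then show ?thesis using that by (simp add: poly_monom)
  qed
  then have "monom 1 N dvd map_poly (\<lambda>q. poly q 0) P"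
    by (simp add: monom_1_dvd_iff' coeff_map_poly)
  then obtain R where R: "map_poly (\<lambda>q. poly q 0) P = monom 1 N * R" ..
  have "poly (map_poly (\<lambda>q. poly q 0) P) e = poly (poly P [:e:]) 0" for e
    by (induction P) (simp_all add: map_poly_pCons)
  then have "f 0 e = e ^ N * poly R e" for e
    by (simp add: P R poly_monom)
  then show ?thesis by blast
qed

lemma poly_eq_power_of_linear:
  fixes g :: "'a::{idom,ring_char_0} poly"
  assumes "degree g \<le> N" "\<And>x. poly g x = (x - r) ^ N * poly h (x - r)"
  shows "g = smult (coeff g N) ([:- r, 1:] ^ N)"
proof -
  have g: "g = [:- r, 1:] ^ N * (h \<circ>\<^sub>p [:- r, 1:])"
    by (rule poly_eqI_cofinite[of "{}"]) (simp_all add: assms(2) poly_pcompose algebra_simps)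
  show ?thesis
  proof (cases "h = 0")
    case False
    have "degree (h \<circ>\<^sub>p [:- r, 1:]) = degree h" by (simp add: degree_pcompose)
    moreover have "h \<circ>\<^sub>p [:- r, 1:] \<noteq> 0" using False by (simp add: pcompose_eq_0_iff)
    ultimately have "degree g = N + degree h"
      using g by (simp add: degree_mult_eq degree_power_eq)
    then have "degree h = 0" using assms(1) by simp
    then obtain a where a: "h = [:a:]" by (rule degree_eq_zeroE)
    then have g': "g = smult a ([:- r, 1:] ^ N)" using g by simp
    have "coeff ([:- r, 1:] ^ N) N = 1"
      using lead_coeff_power[of "[:- r, 1:]" N] by (simp add: degree_power_eq)
    then show ?thesis using g' by simp
  qed (use g in simp)
qed

subsection \<open>Coefficients and values of polynomials in four variables\<close>

lemma poly_as_sum_upto: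
  fixes p :: "'a::comm_ring_1 poly"
  assumes "\<And>i. i > D \<Longrightarrow> coeff p i = 0"
  shows "poly p x = (\<Sum>i\<le>D. coeff p i * x ^ i)"
proof -
  have "degree p \<le> D" using assms by (intro degree_le) auto
  then have "(\<Sum>i\<le>D. coeff p i * x ^ i) = (\<Sum>i\<le>degree p. coeff p i * x ^ i)"
    by (intro sum.mono_neutral_right) (auto simp: coeff_eq_0)
  then show ?thesis by (simp add: poly_altdef)
qed

lemma ev_sum_upto:
  assumes "\<And>i j k l. D < i \<or> D < j \<or> D < k \<or> D < l \<Longrightarrow> coeff4 p i j k l = 0"
  shows "ev p x y z w =
    (\<Sum>i\<le>D. \<Sum>j\<le>D. \<Sum>k\<le>D. \<Sum>l\<le>D. coeff4 p i j k l * x ^ i * y ^ j * z ^ k * w ^ l)"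
proof -
  have 3: "poly (coeff (coeff (coeff p i) j) k) w = (\<Sum>l\<le>D. coeff4 p i j k l * w ^ l)" for i j k
    unfolding coeff4_def
    by (rule poly_as_sum_upto) (use assms in \<open>auto simp: coeff4_def\<close>)
  have 2: "poly (poly (coeff (coeff p i) j) [:z:]) w =
      (\<Sum>k\<le>D. \<Sum>l\<le>D. coeff4 p i j k l * z ^ k * w ^ l)" for i j
    by (subst poly_as_sum_upto[of D])
      (use assms in \<open>auto simp: coeff4_def poly_eq_iff poly_sum 3 sum_distrib_left sum_distrib_right mult_ac
          poly_power intro!: sum.cong\<close>)
  have 1: "poly (poly (poly (coeff p i) [:[:y:]:]) [:z:]) w =
      (\<Sum>j\<le>D. \<Sum>k\<le>D. \<Sum>l\<le>D. coeff4 p i j k l * y ^ j * z ^ k * w ^ l)" for i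
    by (subst poly_as_sum_upto[of D])
      (use assms in \<open>auto simp: coeff4_def poly_eq_iff poly_sum 2 sum_distrib_left sum_distrib_right mult_ac
          poly_power intro!: sum.cong\<close>)
  show ?thesis
    unfolding ev_def
    by (subst poly_as_sum_upto[of D])
      (use assms in \<open>auto simp: coeff4_def poly_eq_iff poly_sum 1 sum_distrib_left sum_distrib_right mult_ac
          poly_power intro!: sum.cong\<close>)
qed

lemma coeff4_eq_0_if_total_degree_less:
  "total_degree p < i + j + k + l \<Longrightarrow> coeff4 p i j k l = 0"
proof (rule ccontr)
  assume "total_degree p < i + j + k + l" "coeff4 p i j k l \<noteq> 0"
  moreover from this(2) have "i + j + k + l \<le> total_degree p"
    unfolding total_degree_def using finite_exponent_sums[of p] by (intro Max_ge) auto
  ultimately show False by simp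
qed

lemma ev_eqI:
  fixes p q :: "'a::field_char_0 poly4"
  assumes "\<And>x y z w. ev p x y z w = ev q x y z w"
  shows "p = q"
proof -
  have 3: "r = s" if "\<And>y z w. poly (poly (poly r [:[:y:]:]) [:z:]) w
      = poly (poly (poly s [:[:y:]:]) [:z:]) w"
    for r s :: "'a poly poly poly"
  proof (rule ccontr)
    assume "r \<noteq> s"
    then have "finite {a. poly (r - s) a = 0}" by (intro poly_roots_finite) simp
    moreover have "poly r [:[:y:]:] = poly s [:[:y:]:]" for y
      by (rule poly2_eqI_cofinite[of "{}"]) (simp_all add: that)
    then have "range (\<lambda>y. [:[:y:]:]) \<subseteq> {a. poly (r - s) a = 0}" by auto
    ultimately have "finite (range (\<lambda>y::'a. [:[:y:]:]))" by (rule finite_subset[rotated])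
    then have "finite (UNIV :: 'a set)" by (rule finite_imageD) (simp add: inj_on_def)
    then show False using infinite_UNIV_char_0 by blast
  qed
  show ?thesis
  proof (rule ccontr)
    assume "p \<noteq> q"
    then have "finite {a. poly (p - q) a = 0}" by (intro poly_roots_finite) simp
    moreover have "poly p [:[:[:x:]:]:] = poly q [:[:[:x:]:]:]" for x
      by (rule 3) (use assms in \<open>simp add: ev_def\<close>)
    then have "range (\<lambda>x. [:[:[:x:]:]:]) \<subseteq> {a. poly (p - q) a = 0}" by auto
    ultimately have "finite (range (\<lambda>x::'a. [:[:[:x:]:]:]))" by (rule finite_subset[rotated])
    then have "finite (UNIV :: 'a set)" by (rule finite_imageD) (simp add: inj_on_def)
    then show False using infinite_UNIV_char_0 by blast
  qed
qed

section \<open>Regular Hamiltonians and their degree in x and z\<close>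

text \<open>
  The hypotheses on \<open>K\<close> as identities between functions. The element \<open>t\<close> becomes the variable of
  \<open>\<complex>(t)\<close> at the end, where \<open>64 t\<^sup>3 + 27\<close> has to be inverted. The parameter \<open>\<alpha>\<^sub>i\<close> is written \<open>ai\<close> in
  the formal text.
\<close>

locale regular_hamiltonian =
  fixes t a0 a1 a2 :: "'a::field_char_0" and K K0 K1 K2 :: "'a poly4"
  assumes t_nonzero: "t \<noteq> 0"
    and degree_le_6: "6 < i + j + k + l \<Longrightarrow> coeff4 K i j k l = 0"
    and regular_r0: "y \<noteq> 0 \<Longrightarrow> ev K ((a0 - x * y) * y) (1 / y) z w = ev K0 x y z w"
    and regular_r1: "x \<noteq> 0 \<Longrightarrow>
      ev K0 (1 / x) (t - w\<^sup>2 - (x * y + a1) * x) (z + 2 * w / x) w + 1 / x = ev K1 x y z w"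
    and regular_r2: "w \<noteq> 0 \<Longrightarrow> ev K x (y + 1 / w) ((a2 - z * w) * w - x) (1 / w) = ev K2 x y z w"
begin

lemma ev_K_xy:
  "ev K x y z w = (\<Sum>i\<le>6. \<Sum>j\<le>6. poly (poly (coeff (coeff K i) j) [:z:]) w * x ^ i * y ^ j)"
proof -
  have 2: "coeff (coeff K i) j = 0" if "6 < i \<or> 6 < j" for i j
    using degree_le_6[of i j] that by (auto simp: coeff4_def poly_eq_iff)
  then have 1: "coeff K i = 0" if "6 < i" for i
    using that by (auto simp: poly_eq_iff)
  have "poly (poly (poly (coeff K i) [:[:y:]:]) [:z:]) w =
      (\<Sum>j\<le>6. poly (poly (coeff (coeff K i) j) [:z:]) w * y ^ j)" for i
    by (subst poly_as_sum_upto[of 6]) (auto simp: 2 poly_sum)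
  then show ?thesis
    unfolding ev_def
    by (subst poly_as_sum_upto[of 6]) (auto simp: 1 poly_sum sum_distrib_left sum_distrib_right mult_ac)
qed

text \<open>
  Grade \<open>K\<close> by the degree in \<open>y\<close> minus the degree in \<open>x\<close>. In the chart \<open>r\<^sub>0\<close> one has
  \<open>x y = \<alpha>\<^sub>0 - x\<^sub>0 y\<^sub>0\<close> and \<open>y = 1/y\<^sub>0\<close>. So the part of degree \<open>n > 0\<close>, which is \<open>y\<^sup>n\<close> times a
  polynomial in \<open>x y\<close>, has no pole along \<open>y\<^sub>0 = 0\<close> iff this polynomial is divisible by \<open>(x y - \<alpha>\<^sub>0)\<^sup>n\<close>.
  As its degree is at most \<open>(6 - n) / 2\<close>, only multiples of \<open>x y - \<alpha>\<^sub>0\<close> for \<open>n = 1\<close> and of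
  \<open>(x y - \<alpha>\<^sub>0)\<^sup>2\<close> for \<open>n = 2\<close> remain. The proof extracts the conditions from the expansion of \<open>y\<^sup>6 K\<close>
  at \<open>x = 0\<close> and \<open>x = 1\<close>.
\<close>

lemma K_r0_relations:
  shows "3 \<le> j \<Longrightarrow> coeff4 K 0 j k l = 0"
    and "4 \<le> j \<Longrightarrow> coeff4 K 1 j k l = 0"
    and "coeff4 K 1 3 k l = - 2 * a0 * coeff4 K 2 4 k l"
    and "coeff4 K 0 2 k l = a0\<^sup>2 * coeff4 K 2 4 k l"
    and "coeff4 K 0 1 k l = - a0 * coeff4 K 1 2 k l - a0\<^sup>2 * coeff4 K 2 3 k l"
proof -
  define C where "C z w i j = poly (poly (coeff (coeff K i) j) [:z:]) w" for i j z w
  have C0: "C z w i j = 0" if "6 < i + j" for i j z w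
  proof -
    have "coeff (coeff K i) j = 0"
      using degree_le_6[of i j] that by (auto simp: coeff4_def poly_eq_iff)
    then show ?thesis by (simp add: C_def)
  qed
  define P where "P z w x =
    (\<Sum>i\<le>6. \<Sum>j\<le>6. smult (C z w i j) (monom 1 (6 + i - j) * [:a0, - x:] ^ i))" for z w x
  have van: "coeff (P z w x) m = 0" if "m < 6" for z w x m
  proof (rule poly_vanishing_order[of "{0}" _ 6 "\<lambda>y. ev K0 x y z w"])
    fix y :: 'a assume "y \<notin> {0}"
    then have y: "y \<noteq> 0" by simp
    have "y ^ (6 + i - j) * (a0 - x * y) ^ i = y ^ 6 * (((a0 - x * y) * y) ^ i * (1 / y) ^ j)" if "j \<le> 6"
        for i j
      using y that by (simp add: power_diff power_add power_mult_distrib power_divide)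
    then have "poly (P z w x) y = y ^ 6 * ev K ((a0 - x * y) * y) (1 / y) z w"
      unfolding P_def ev_K_xy C_def[symmetric]
      by (auto simp: poly_sum poly_monom sum_distrib_left algebra_simps intro!: sum.cong)
    then show "poly (P z w x) y = y ^ 6 * ev K0 x y z w"
      using regular_r0[OF y] by simp
  next
    show "polyfun (\<lambda>y. ev K0 x y z w)"
      by (rule polyfun_if_polyfun2) (intro polyfun2_intros)
  qed (use that in auto)
  have six: "{..6::nat} = {0,1,2,3,4,5,6}" by auto
  have coeff_P: "coeff (P z w x) m = (\<Sum>i\<le>6. \<Sum>j\<le>6. C z w i j *
      (if m < 6 + i - j then 0 else coeff ([:a0, - x:] ^ i) (m - (6 + i - j))))" for z w x m
    unfolding P_def coeff_sum coeff_smult coeff_monom_mult mult_1_left ..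
  have x0: "coeff (P z w 0) m = 0" "coeff (P z w 1) m = 0" if "m < 6" for z w m
    using van[OF that] by auto
  have low: "coeff [:a, b:] 2 = 0" "coeff [:a, b:] 3 = 0" "coeff [:a, b, b':] 3 = 0" for a b b' :: 'a
    by (simp_all add: numeral_2_eq_2 numeral_3_eq_3)
  have rows: "C z w 0 6 = 0" "C z w 0 5 = 0" "C z w 0 4 + C z w 1 5 * a0 = 0"
    "C z w 0 3 + C z w 1 4 * a0 = 0" "C z w 0 3 + C z w 1 4 * a0 - C z w 1 5 = 0"
    "C z w 0 2 + C z w 1 3 * a0 + C z w 2 4 * a0\<^sup>2 = 0"
    "C z w 0 2 + C z w 1 3 * a0 - C z w 1 4 + C z w 2 4 * a0\<^sup>2 = 0"
    "C z w 0 1 + C z w 1 2 * a0 + C z w 2 3 * a0\<^sup>2 = 0"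
    "C z w 0 1 + C z w 1 2 * a0 - C z w 1 3 + C z w 2 3 * a0\<^sup>2 - C z w 2 4 * 2 * a0 = 0" for z w
    using x0[of 0 z w] x0[of 1 z w] x0[of 2 z w] x0[of 3 z w] x0[of 4 z w] x0[of 5 z w]
    unfolding coeff_P six
    by (simp_all add: C0 power2_eq_square low algebra_simps)
  have e: "C z w 1 5 = 0" "C z w 1 4 = 0" "C z w 0 3 = 0" "C z w 0 4 = 0" "C z w 0 5 = 0" "C z w 0 6 = 0"
    "C z w 1 3 = - 2 * a0 * C z w 2 4" "C z w 0 2 = a0\<^sup>2 * C z w 2 4"
    "C z w 0 1 = - a0 * C z w 1 2 - a0\<^sup>2 * C z w 2 3" for z w
    using rows[of z w] by algebra+
  let ?q = "\<lambda>i j. coeff (coeff K i) j"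
  have q: "?q 0 3 = 0" "?q 0 4 = 0" "?q 0 5 = 0" "?q 0 6 = 0" "?q 1 4 = 0" "?q 1 5 = 0"
    "?q 1 3 = smult [:- 2 * a0:] (?q 2 4)" "?q 0 2 = smult [:a0\<^sup>2:] (?q 2 4)"
    "?q 0 1 = smult [:- a0:] (?q 1 2) - smult [:a0\<^sup>2:] (?q 2 3)"
    by (rule poly2_eqI_cofinite[of "{}"], simp, use e in \<open>simp add: C_def\<close>)+
  show "coeff4 K 1 3 k l = - 2 * a0 * coeff4 K 2 4 k l"
    and "coeff4 K 0 2 k l = a0\<^sup>2 * coeff4 K 2 4 k l"
    and "coeff4 K 0 1 k l = - a0 * coeff4 K 1 2 k l - a0\<^sup>2 * coeff4 K 2 3 k l"
    by (simp_all add: coeff4_def q del: One_nat_def)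
  show "coeff4 K 0 j k l = 0" if "3 \<le> j"
  proof (cases "j \<le> 6")
    case True
    with that have "j = 3 \<or> j = 4 \<or> j = 5 \<or> j = 6" by auto
    then show ?thesis by (auto simp: coeff4_def q)
  qed (use degree_le_6[of 0 j k l] in auto)
  show "coeff4 K 1 j k l = 0" if "4 \<le> j"
  proof (cases "j \<le> 5")
    case True
    with that have "j = 4 \<or> j = 5" by auto
    then show ?thesis by (auto simp: coeff4_def q simp del: One_nat_def)
  qed (use degree_le_6[of 1 j k l] in auto)
qed

end

lemma cube_of_sum_square:
  "(c + w\<^sup>2) ^ 3 = c ^ 3 + w * (w * (3 * c\<^sup>2 + 3 * c * w\<^sup>2 + w ^ 4))" for c w :: "'a::comm_ring_1"
  by (simp add: power2_eq_square power3_eq_cube power4_eq_xxxx algebra_simps)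

text \<open>
  The polynomials \<open>t - w\<^sup>2\<close> and \<open>w\<close> are coprime because \<open>t \<noteq> 0\<close>. The proof writes \<open>t\<^sup>3\<close> as \<open>(t - w\<^sup>2)\<^sup>3\<close>
  plus a multiple of \<open>w\<^sup>2\<close>, which works over every field.
\<close>

lemma dvd_of_power_dvd_power_mult:
  fixes f :: "'a::field poly"
  assumes "t \<noteq> 0" "[:t, 0, - 1:] ^ 3 dvd [:0, 1:] ^ n * f"
  shows "[:t, 0, - 1:] ^ 3 dvd f"
  using assms(2)
proof (induction n)
  case (Suc n)
  let ?c = "[:t, 0, - 1:]" and ?w = "[:0, 1:] :: 'a poly"
  define r where "r = ?w * (3 * ?c\<^sup>2 + 3 * ?c * ?w\<^sup>2 + ?w ^ 4)"
  have "[:t:] = ?c + ?w\<^sup>2" by (simp add: power2_eq_square)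
  then have "[:t:] ^ 3 = (?c + ?w\<^sup>2) ^ 3" by simp
  then have r: "[:t ^ 3:] = ?c ^ 3 + ?w * r"
    by (simp only: poly_const_pow cube_of_sum_square r_def)
  have "smult (t ^ 3) f' = ?c ^ 3 * f' + (?w * f') * r" for f'
  proof -
    have "smult (t ^ 3) f' = [:t ^ 3:] * f'" by simp
    then show ?thesis unfolding r by (simp only: distrib_right distrib_left mult_ac)
  qed
  moreover have "?c ^ 3 dvd ?w * (?w ^ n * f)" using Suc.prems by (simp add: mult.assoc)
  ultimately have "?c ^ 3 dvd smult (t ^ 3) (?w ^ n * f)"
    by (metis dvd_add dvd_triv_left dvd_mult2)
  then have "?c ^ 3 dvd ?w ^ n * f" using assms(1) by (simp add: dvd_smult_iff)
  then show ?case by (rule Suc.IH)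
qed simp

text \<open>
  The curve \<open>y (t - w\<^sup>2) = 1\<close> is an irreducible cubic, so a polynomial of degree at most 3 in \<open>y, w\<close>
  that vanishes on it is a multiple of its equation \<open>y w\<^sup>2 - t y + 1\<close>. Here \<open>g\<close> are the coefficients
  of the polynomial, and the curve is parametrized by \<open>w\<close>, which turns the vanishing into a linear
  system; the denominator \<open>(t - w\<^sup>2)\<^sup>3\<close> is cleared.
\<close>

lemma cubic_vanishing_on_curve:
  fixes g :: "nat \<Rightarrow> nat \<Rightarrow> 'a::field_char_0"
  assumes "\<And>w. t - w\<^sup>2 \<noteq> 0 \<Longrightarrow> (\<Sum>j\<le>3. \<Sum>l\<le>3. g j l * (t - w\<^sup>2) ^ (3 - j) * w ^ l) = 0"
    and "\<And>j l. 3 < j + l \<Longrightarrow> g j l = 0"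
  shows "g j l = (if (j, l) \<in> {(0, 0), (1, 2)} then g 1 2 else if (j, l) = (1, 0) then - t * g 1 2 else 0)"
proof -
  have three: "{..3::nat} = {0,1,2,3}" by auto
  have "[:t ^ 3 * g 0 0 + t\<^sup>2 * g 1 0 + t * g 2 0 + g 3 0,
      t ^ 3 * g 0 1 + t\<^sup>2 * g 1 1 + t * g 2 1,
      t ^ 3 * g 0 2 - 3 * t\<^sup>2 * g 0 0 + t\<^sup>2 * g 1 2 - 2 * t * g 1 0 - g 2 0,
      t ^ 3 * g 0 3 - 3 * t\<^sup>2 * g 0 1 - 2 * t * g 1 1 - g 2 1,
      - 3 * t\<^sup>2 * g 0 2 + 3 * t * g 0 0 - 2 * t * g 1 2 + g 1 0,
      - 3 * t\<^sup>2 * g 0 3 + 3 * t * g 0 1 + g 1 1,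
      3 * t * g 0 2 - g 0 0 + g 1 2, 3 * t * g 0 3 - g 0 1, - g 0 2, - g 0 3:] = 0" (is "?p = 0")
  proof (rule poly_eqI_cofinite)
    show "finite {w. poly [:t, 0, - 1:] w = 0}" by (rule poly_roots_finite) simp
  next
    fix w assume "w \<notin> {w. poly [:t, 0, - 1:] w = 0}"
    then have "t - w\<^sup>2 \<noteq> 0" by (simp add: power2_eq_square)
    from assms(1)[OF this]
    have "(g 0 0 + g 0 1 * w + g 0 2 * w\<^sup>2 + g 0 3 * w ^ 3) * (t - w\<^sup>2) ^ 3
        + (g 1 0 + g 1 1 * w + g 1 2 * w\<^sup>2) * (t - w\<^sup>2)\<^sup>2
        + (g 2 0 + g 2 1 * w) * (t - w\<^sup>2) + g 3 0 = 0"
      by (simp add: three assms(2) algebra_simps)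
    moreover have "poly ?p w = (g 0 0 + g 0 1 * w + g 0 2 * w\<^sup>2 + g 0 3 * w ^ 3) * (t - w\<^sup>2) ^ 3
        + (g 1 0 + g 1 1 * w + g 1 2 * w\<^sup>2) * (t - w\<^sup>2)\<^sup>2
        + (g 2 0 + g 2 1 * w) * (t - w\<^sup>2) + g 3 0"
      by (simp only: poly_pCons poly_0) algebra
    ultimately show "poly ?p w = poly 0 w" by simp
  qed
  then have eqs: "t ^ 3 * g 0 0 + t\<^sup>2 * g 1 0 + t * g 2 0 + g 3 0 = 0"
    "t ^ 3 * g 0 1 + t\<^sup>2 * g 1 1 + t * g 2 1 = 0"
    "t ^ 3 * g 0 2 - 3 * t\<^sup>2 * g 0 0 + t\<^sup>2 * g 1 2 - 2 * t * g 1 0 - g 2 0 = 0"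
    "t ^ 3 * g 0 3 - 3 * t\<^sup>2 * g 0 1 - 2 * t * g 1 1 - g 2 1 = 0"
    "- 3 * t\<^sup>2 * g 0 2 + 3 * t * g 0 0 - 2 * t * g 1 2 + g 1 0 = 0"
    "- 3 * t\<^sup>2 * g 0 3 + 3 * t * g 0 1 + g 1 1 = 0"
    "3 * t * g 0 2 - g 0 0 + g 1 2 = 0" "3 * t * g 0 3 - g 0 1 = 0" "g 0 2 = 0" "g 0 3 = 0"
    unfolding pCons_eq_0_iff neg_equal_0_iff_equal by blast+
  have r1: "g 0 3 = 0" "g 0 2 = 0" "g 0 1 = 0" "g 0 0 = g 1 2" "g 1 1 = 0"
    using eqs(5-10) by simp_all
  have r2: "g 1 0 = - t * g 1 2" "g 2 1 = 0" using eqs(4,5) r1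
      by (simp_all add: algebra_simps eq_neg_iff_add_eq_0)
  have r3: "g 2 0 = 0" using eqs(3) r1 r2 by (simp add: algebra_simps power2_eq_square)
  have r4: "g 3 0 = 0" using eqs(1) r1 r2 r3 by (simp add: algebra_simps power2_eq_square power3_eq_cube)
  note r = r1 r2 r3 r4
  consider "3 < j + l" | "j = 0" "l \<le> 3" | "j = 1" "l \<le> 2" | "j = 2" "l \<le> 1" | "j = 3" "l = 0"
    by linarith
  then show ?thesis
  proof cases
    case 1
    then show ?thesis using assms(2)[of j l] by auto
  next
    case 2
    then have "l = 0 \<or> l = 1 \<or> l = 2 \<or> l = 3" by auto
    then show ?thesis using 2 r by auto
  next
    case 3
    then have "l = 0 \<or> l = 1 \<or> l = 2" by auto
    then show ?thesis using 3 r by auto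
  next
    case 4
    then have "l = 0 \<or> l = 1" by auto
    then show ?thesis using 4 r by auto
  qed (use r in auto)
qed

context regular_hamiltonian
begin

lemma regular_r0_r1:
  assumes "x \<noteq> 0" "Y = t - w\<^sup>2 - (x * y + a1) * x" "Y \<noteq> 0"
  shows "ev K ((a0 - Y / x) * Y) (1 / Y) (z + 2 * w / x) w + 1 / x = ev K1 x y z w"
  using regular_r0[OF assms(3), of "1 / x" "z + 2 * w / x" w] regular_r1[OF assms(1), of w y z]
  by (simp add: assms(2))

text \<open>
  The coefficient of \<open>x\<^sup>i z\<^sup>k\<close> in \<open>K\<close> is a function of \<open>y, w\<close>. Its homogenized form is polynomial in
  the coordinate \<open>y\<^sub>0 = 1/y\<close> of the chart \<open>r\<^sub>0\<close>.
\<close>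

definition xz_coeff :: "nat \<Rightarrow> nat \<Rightarrow> 'a \<Rightarrow> 'a \<Rightarrow> 'a" where
  "xz_coeff i k y w = (\<Sum>j\<le>6. \<Sum>l\<le>6. coeff4 K i j k l * y ^ j * w ^ l)"

lemma ev_K_xz: "ev K x y z w = (\<Sum>i\<le>6. \<Sum>k\<le>6. xz_coeff i k y w * x ^ i * z ^ k)"
proof -
  have "ev K x y z w = (\<Sum>i\<le>6. \<Sum>j\<le>6. \<Sum>k\<le>6. \<Sum>l\<le>6. coeff4 K i j k l * x ^ i * y ^ j * z ^ k * w ^ l)"
    by (rule ev_sum_upto) (use degree_le_6 in auto)
  also have "\<dots> = (\<Sum>i\<le>6. \<Sum>k\<le>6. xz_coeff i k y w * x ^ i * z ^ k)"
    unfolding xz_coeff_def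
    by (subst (2) sum.swap) (simp add: sum_distrib_left sum_distrib_right mult_ac)
  finally show ?thesis .
qed

definition xz_coeff_hom :: "nat \<Rightarrow> nat \<Rightarrow> 'a \<Rightarrow> 'a \<Rightarrow> 'a" where
  "xz_coeff_hom i k y w = (\<Sum>j\<le>6. \<Sum>l\<le>6. coeff4 K i j k l * y ^ (6 - j) * w ^ l)"

lemma xz_coeff_hom: "y \<noteq> 0 \<Longrightarrow> xz_coeff_hom i k y w = y ^ 6 * xz_coeff i k (1 / y) w"
  unfolding xz_coeff_def xz_coeff_hom_def sum_distrib_left
  by (intro sum.cong refl) (simp add: power_diff power_divide)

text \<open>
  Let \<open>N\<close> bound the degree of \<open>K\<close> in \<open>x, z\<close>, and let \<open>C\<^sub>i(y, w)\<close> be the coefficient of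
  \<open>x\<^sup>i z\<^bsup>N-i\<^esup>\<close>. In the chart \<open>r\<^sub>1\<close> consider the surface \<open>y\<^sub>1 = 0\<close>, \<open>w\<^sub>1 = w\<close>. On it
  \<open>x = (\<alpha>\<^sub>0 x\<^sub>1 - Y) Y / x\<^sub>1\<close>, \<open>y = 1/Y\<close> and \<open>z = (2 w + x\<^sub>1 z\<^sub>1) / x\<^sub>1\<close> with \<open>Y = c - \<alpha>\<^sub>1 x\<^sub>1\<close> and
  \<open>c = t - w\<^sup>2\<close>. So \<open>x\<^sub>1\<^sup>N Y\<^sup>6 (K + x\<^sub>0)\<close> is a polynomial in \<open>x\<^sub>1\<close> and \<open>e = x\<^sub>1 z\<^sub>1\<close>, and as a polynomial
  in \<open>x\<^sub>1\<close> and \<open>z\<^sub>1\<close> it is divisible by \<open>x\<^sub>1\<^sup>N\<close>. By \<open>blow_up_vanishing\<close> the part without \<open>x\<^sub>1\<close>, to which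
  only the \<open>C\<^sub>i\<close> contribute (\<open>x\<^sub>0 = 1/x\<^sub>1\<close> does not because \<open>N \<ge> 2\<close>), is a multiple of \<open>e\<^sup>N\<close>. In terms
  of \<open>Z = 2 w + e\<close> this says that \<open>\<Sum>\<^sub>i (- c\<^sup>2)\<^sup>i C\<^sub>i(1/c, w) Z\<^bsup>N-i\<^esup> = C\<^sub>0 (Z - 2 w)\<^sup>N\<close>. The
  lemma states it multiplied by \<open>c\<^sup>6\<close>.
\<close>

lemma top_coefficients_r1:
  assumes N: "2 \<le> N" "N \<le> 6" "\<And>i j k l. N < i + k \<Longrightarrow> coeff4 K i j k l = 0"
    and w: "t - w\<^sup>2 \<noteq> 0"
  defines "c \<equiv> t - w\<^sup>2"
  defines "B \<equiv> \<lambda>i. (- c\<^sup>2) ^ i * xz_coeff_hom i (N - i) c w"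
  shows "(\<Sum>i\<le>N. monom (B i) (N - i)) = smult (B 0) ([:- 2 * w, 1:] ^ N)" (is "?g = _")
proof -
  have hom_0: "xz_coeff_hom i k y w = 0" if "N < i + k" for i k y
    using N(3)[OF that] by (simp add: xz_coeff_hom_def)
  \<comment> \<open>The summands with \<open>i + k > N\<close> vanish, so the truncated exponent \<open>N - (i + k)\<close> does no harm.\<close>
  define Y where "Y x = c - a1 * x" for x
  define G where "G x e = (\<Sum>i\<le>6. \<Sum>k\<le>6. x ^ (N - (i + k)) * ((a0 * x - Y x) * Y x) ^ i * (2 * w
      + e) ^ k * xz_coeff_hom i k (Y x) w)
      + Y x ^ 6 * x ^ (N - 1)" for x e
  have "\<exists>R. \<forall>e. G 0 e = e ^ N * poly R e"
  proof (rule blow_up_vanishing)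
    show "polyfun2 G"
      unfolding G_def Y_def xz_coeff_hom_def by (intro polyfun2_intros)
    show "polyfun2 (\<lambda>x z. Y x ^ 6 * ev K1 x 0 z w)"
      unfolding Y_def by (intro polyfun2_intros)
    have "finite {x. poly [:c, - a1:] x = 0}"
      using w by (intro poly_roots_finite) (simp add: c_def)
    then show "finite ({0} \<union> {x. Y x = 0})" by (simp add: Y_def mult.commute)
  next
    fix x z assume "x \<notin> {0} \<union> {x. Y x = 0}"
    then have x: "x \<noteq> 0" and Yx: "Y x \<noteq> 0" by auto
    have "x ^ N * (Y x ^ 6 * (xz_coeff i k (1 / Y x) w * ((a0 - Y x / x) * Y x) ^ i * (z + 2 * w / x) ^ k))
        = x ^ (N - (i + k)) * ((a0 * x - Y x) * Y x) ^ i * (2 * w + x * z) ^ k * xz_coeff_hom i k (Y x) w"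
            for i k
    proof (cases "N < i + k")
      case True
      then show ?thesis using hom_0[OF True, of "Y x"] Yx by (simp add: xz_coeff_hom)
    next
      case False
      then have "x ^ N = x ^ (N - (i + k)) * x ^ i * x ^ k" by (simp add: power_add[symmetric])
      then have "x ^ N * (Y x ^ 6 * (xz_coeff i k (1 / Y x) w * U * V))
          = x ^ (N - (i + k)) * (x ^ i * U) * (x ^ k * V) * (Y x ^ 6 * xz_coeff i k (1 / Y x) w)" for U V
        by (simp only: mult_ac)
      moreover have "x ^ i * ((a0 - Y x / x) * Y x) ^ i = ((a0 * x - Y x) * Y x) ^ i"
        using x by (simp add: power_mult_distrib[symmetric] field_simps)
      moreover have "x ^ k * (z + 2 * w / x) ^ k = (2 * w + x * z) ^ k"
        using x by (simp add: power_mult_distrib[symmetric] field_simps)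
      ultimately show ?thesis
        unfolding xz_coeff_hom[OF Yx] by (simp only:)
    qed
    moreover have "x ^ N * (Y x ^ 6 * (1 / x)) = Y x ^ 6 * x ^ (N - 1)"
      using x N by (simp add: power_diff)
    ultimately have "G x (x * z) = x ^ N * (Y x ^ 6 * (ev K ((a0 - Y x / x) * Y x) (1 / Y x) (z
        + 2 * w / x) w + 1 / x))"
      unfolding G_def ev_K_xz distrib_left sum_distrib_left by simp
    also have "\<dots> = x ^ N * (Y x ^ 6 * ev K1 x 0 z w)"
      using regular_r0_r1[OF x, of "Y x" w 0 z] Yx by (simp add: Y_def c_def algebra_simps)
    finally show "G x (x * z) = x ^ N * (Y x ^ 6 * ev K1 x 0 z w)" .
  qed
  then obtain R where R: "\<And>e. G 0 e = e ^ N * poly R e" by blast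
  have G0: "G 0 e = poly ?g (2 * w + e)" for e
  proof -
    have "(\<Sum>k\<le>6. 0 ^ (N - (i + k)) * ((a0 * 0 - Y 0) * Y 0) ^ i * (2 * w
        + e) ^ k * xz_coeff_hom i k (Y 0) w)
        = (if i \<le> N then B i * (2 * w + e) ^ (N - i) else 0)" for i
    proof -
      have "0 ^ (N - (i + k)) * ((a0 * 0 - Y 0) * Y 0) ^ i * (2 * w + e) ^ k * xz_coeff_hom i k (Y 0) w
          = (if k = N - i then if i \<le> N then B i * (2 * w + e) ^ (N - i) else 0 else 0)" for k
      proof (cases "N < i + k")
        case True
        then show ?thesis using hom_0[OF True] by auto
      next
        case False
        then show ?thesis by (auto simp: B_def Y_def power2_eq_square)
      qed
      moreover have "N - i \<le> 6" using N(2) by simp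
      ultimately show ?thesis by simp
    qed
    then have "G 0 e = (\<Sum>i\<le>6. if i \<le> N then B i * (2 * w + e) ^ (N - i) else 0)"
      using N(1) by (simp add: G_def)
    also have "\<dots> = (\<Sum>i\<le>N. B i * (2 * w + e) ^ (N - i))"
      using N(2) by (intro sum.mono_neutral_cong_right) auto
    finally show ?thesis by (simp add: poly_sum poly_monom)
  qed
  have "?g = smult (coeff ?g N) ([:- (2 * w), 1:] ^ N)"
  proof (rule poly_eq_power_of_linear)
    show "degree ?g \<le> N"
      by (rule degree_sum_le) (auto intro: order_trans[OF degree_monom_le])
    show "poly ?g x = (x - 2 * w) ^ N * poly R (x - 2 * w)" for x
      using G0[of "x - 2 * w"] R[of "x - 2 * w"] by simp
  qed
  moreover have "coeff ?g N = B 0"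
  proof -
    have "coeff ?g N = (\<Sum>i\<le>N. if i = 0 then B 0 else 0)"
      unfolding coeff_sum by (intro sum.cong refl) auto
    then show ?thesis by simp
  qed
  ultimately show ?thesis by simp
qed

text \<open>
  By the regularity in \<open>r\<^sub>0\<close> the coefficient \<open>C\<^sub>0\<close> of \<open>z\<^sup>N\<close> is a polynomial in \<open>w\<close> alone. The constant
  term in \<open>Z\<close> of \<open>top_coefficients_r1\<close> shows that \<open>c\<^sup>3\<close> divides \<open>w\<^sup>N C\<^sub>0\<close>, hence \<open>C\<^sub>0\<close>. The degree of
  \<open>c\<^sup>3\<close> in \<open>w\<close> is 6, that of \<open>C\<^sub>0\<close> is at most \<open>6 - N \<le> 3\<close>, so \<open>C\<^sub>0 = 0\<close>. Then all \<open>C\<^sub>i\<close>, whose degrees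
  are at most 3, vanish on the curve \<open>c y = 1\<close>.
\<close>

lemma top_coefficients:
  assumes N: "3 \<le> N" "N \<le> 6" "\<And>i j k l. N < i + k \<Longrightarrow> coeff4 K i j k l = 0"
    and ik: "i + k = N"
  shows "coeff4 K i j k l = (if (j, l) \<in> {(0, 0), (1, 2)} then coeff4 K i 1 k 2
      else if (j, l) = (1, 0) then - t * coeff4 K i 1 k 2 else 0)"
    and "coeff4 K 0 j N l = 0"
proof -
  define B where "B w i = (- (t - w\<^sup>2)\<^sup>2) ^ i * xz_coeff_hom i (N - i) (t - w\<^sup>2) w" for w i
  have low: "coeff4 K i j k l = 0" if "i + k = N" "3 < j \<or> 3 < l \<or> 3 < j + l" for i j k l
    using degree_le_6[of i j k l] N(1) that by auto
  have hom_3: "xz_coeff_hom i k c w = c ^ 3 * (\<Sum>j\<le>3. \<Sum>l\<le>3. coeff4 K i j k l * c ^ (3 - j) * w ^ l)"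
    if "i + k = N" for i k c w
  proof -
    have "xz_coeff_hom i k c w = (\<Sum>j\<le>3. \<Sum>l\<le>6. coeff4 K i j k l * c ^ (6 - j) * w ^ l)"
      unfolding xz_coeff_hom_def using low[OF that] by (intro sum.mono_neutral_right) auto
    also have "\<dots> = (\<Sum>j\<le>3. \<Sum>l\<le>3. coeff4 K i j k l * c ^ (6 - j) * w ^ l)"
      using low[OF that] by (intro sum.cong sum.mono_neutral_right refl) auto
    also have "\<dots> = (\<Sum>j\<le>3. \<Sum>l\<le>3. c ^ 3 * (coeff4 K i j k l * c ^ (3 - j) * w ^ l))"
    proof (intro sum.cong refl)
      fix j l :: nat assume "j \<in> {..3}"
      then have "6 - j = 3 + (3 - j)" by simp
      then have "c ^ (6 - j) = c ^ 3 * c ^ (3 - j)" by (metis power_add)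
      then show "coeff4 K i j k l * c ^ (6 - j) * w ^ l = c ^ 3 * (coeff4 K i j k l * c ^ (3 - j) * w ^ l)"
        by simp
    qed
    finally show ?thesis by (simp only: sum_distrib_left)
  qed
  have zN: "coeff4 K 0 j N l = 0" if "j \<noteq> 0" for j l
  proof -
    have "j = 1 \<or> j = 2 \<or> 3 \<le> j" using that by auto
    then show ?thesis using K_r0_relations(1)[of j N l] K_r0_relations(4,5)[of N l] N(3)[of 1 N 2 l]
        N(3)[of 2 N 3 l] N(3)[of 2 N 4 l]
      by auto
  qed
  define kap where "kap = (\<Sum>l\<le>3. monom (coeff4 K 0 0 N l) l)"
  have poly_kap: "poly kap w = (\<Sum>l\<le>3. coeff4 K 0 0 N l * w ^ l)" for w
    by (simp add: kap_def poly_sum poly_monom)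
  have B0: "B w 0 = (t - w\<^sup>2) ^ 6 * poly kap w" for w
  proof -
    have "(\<Sum>j\<le>3. \<Sum>l\<le>3. coeff4 K 0 j N l * c ^ (3 - j) * w ^ l) = c ^ 3 * poly kap w" for c
    proof -
      have "(\<Sum>j\<le>3. \<Sum>l\<le>3. coeff4 K 0 j N l * c ^ (3 - j) * w ^ l)
          = (\<Sum>j\<in>{0}. \<Sum>l\<le>3. coeff4 K 0 j N l * c ^ (3 - j) * w ^ l)"
        using zN by (intro sum.mono_neutral_right) auto
      then show ?thesis by (simp add: poly_kap sum_distrib_left mult_ac)
    qed
    then show ?thesis using hom_3[of 0 N "t - w\<^sup>2" w] by (simp add: B_def algebra_simps power_add[symmetric])
  qed
  have top: "(\<Sum>i\<le>N. monom (B w i) (N - i)) = smult (B w 0) ([:- 2 * w, 1:] ^ N)"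
    if "t - w\<^sup>2 \<noteq> 0" for w
    using top_coefficients_r1[OF _ N(2,3) that] N(1) by (simp add: B_def)
  have coeff_top: "coeff (\<Sum>i\<le>N. monom (B w i) (N - i)) (N - i) = B w i" if "i \<le> N" for w i
  proof -
    have "coeff (\<Sum>i\<le>N. monom (B w i) (N - i)) (N - i) = (\<Sum>i'\<le>N. if i' = i then B w i else 0)"
      unfolding coeff_sum using that by (intro sum.cong refl) auto
    then show ?thesis using that by simp
  qed
  let ?S = "{w. poly [:t, 0, - 1:] w = 0}"
  have fin: "finite ?S" by (rule poly_roots_finite) simp
  have S: "t - w\<^sup>2 \<noteq> 0" if "w \<notin> ?S" for w using that by (simp add: power2_eq_square)
  have "kap = 0"
  proof -
    define s where "s = (\<Sum>j\<le>3. \<Sum>l\<le>3. smult (coeff4 K N j 0 l) ([:t, 0, - 1:] ^ (3 - j) * monom 1 l))"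
    have poly_s: "poly s w = (\<Sum>j\<le>3. \<Sum>l\<le>3. coeff4 K N j 0 l * (t - w\<^sup>2) ^ (3 - j) * w ^ l)" for w
      by (simp add: s_def poly_sum poly_monom power2_eq_square mult_ac)
    have "[:t, 0, - 1:] ^ (2 * N - 3) * s = [:0, 1:] ^ N * smult (2 ^ N) kap"
    proof (rule poly_eqI_cofinite[OF fin])
      fix w assume "w \<notin> ?S"
      then have c: "t - w\<^sup>2 \<noteq> 0" by (rule S)
      let ?c = "t - w\<^sup>2"
      have "B w N = B w 0 * (- 2 * w) ^ N"
        using coeff_top[of N w] unfolding top[OF c] by (simp add: coeff_0_power)
      moreover have "(- 2 * w) ^ N = (- 1) ^ N * (2 ^ N * w ^ N)"
      proof -
        have "- 2 * w = (- 1) * (2 * w)" by simp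
        then show ?thesis by (simp only: power_mult_distrib)
      qed
      moreover have "(- ?c\<^sup>2) ^ N = (- 1) ^ N * ?c ^ (2 * N)"
        by (subst power_minus) (simp add: power_mult)
      moreover have "xz_coeff_hom N 0 ?c w = ?c ^ 3 * poly s w"
        using hom_3[of N 0 ?c w] by (simp add: poly_s)
      ultimately have "(- 1) ^ N * (?c ^ (2 * N) * (?c ^ 3 * poly s w))
          = (- 1) ^ N * (?c ^ 6 * (poly kap w * (2 ^ N * w ^ N)))"
        unfolding B0 by (simp add: B_def mult_ac)
      then have e: "?c ^ (2 * N) * (?c ^ 3 * poly s w) = ?c ^ 6 * (poly kap w * (2 ^ N * w ^ N))"
        by simp
      have "?c ^ (2 * N) * ?c ^ 3 = ?c ^ 6 * ?c ^ (2 * N - 3)"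
        using N(1) by (simp add: power_add[symmetric] add.commute)
      then have "?c ^ 6 * (?c ^ (2 * N - 3) * poly s w) = ?c ^ 6 * (poly kap w * (2 ^ N * w ^ N))"
        unfolding e[symmetric] by (simp only: mult.assoc[symmetric])
      then have "?c ^ (2 * N - 3) * poly s w = poly kap w * (2 ^ N * w ^ N)" using c by simp
      then show "poly ([:t, 0, - 1:] ^ (2 * N - 3) * s) w = poly ([:0, 1:] ^ N * smult (2 ^ N) kap) w"
        by (simp add: power2_eq_square mult_ac)
    qed
    moreover have "[:t, 0, - 1:] ^ 3 dvd [:t, 0, - 1:] ^ (2 * N - 3) * s"
      using N(1) by (intro dvd_mult2 le_imp_power_dvd) simp
    ultimately have "[:t, 0, - 1:] ^ 3 dvd smult (2 ^ N) kap"
      by (metis dvd_of_power_dvd_power_mult t_nonzero)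
    then have d: "[:t, 0, - 1:] ^ 3 dvd kap" by (simp add: dvd_smult_iff)
    have "degree kap \<le> 3"
      unfolding kap_def by (rule degree_sum_le) (auto intro: order_trans[OF degree_monom_le])
    moreover have "degree ([:t, 0, - 1:] ^ 3) = 6" by (simp add: degree_power_eq)
    ultimately show "kap = 0" using dvd_imp_degree_le[OF d] by auto
  qed
  have "coeff kap l = coeff4 K 0 0 N l" if "l \<le> 3" for l
    using that by (simp add: kap_def coeff_sum)
  then have "coeff4 K 0 0 N l = 0" for l
    using \<open>kap = 0\<close> low[of 0 N 0 l] by (cases "l \<le> 3") auto
  then show "coeff4 K 0 j N l = 0" using zN by (cases "j = 0") auto
  have hom_0: "xz_coeff_hom i k (t - w\<^sup>2) w = 0" if "t - w\<^sup>2 \<noteq> 0" for w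
  proof -
    have "B w i = 0"
      using coeff_top[of i w] top[OF that] B0[of w] \<open>kap = 0\<close> ik by simp
    then show ?thesis using that ik by (auto simp: B_def)
  qed
  show "coeff4 K i j k l = (if (j, l) \<in> {(0, 0), (1, 2)} then coeff4 K i 1 k 2
      else if (j, l) = (1, 0) then - t * coeff4 K i 1 k 2 else 0)"
  proof (rule cubic_vanishing_on_curve)
    show "(\<Sum>j\<le>3. \<Sum>l\<le>3. coeff4 K i j k l * (t - w\<^sup>2) ^ (3 - j) * w ^ l) = 0" if "t - w\<^sup>2 \<noteq> 0" for w
      using hom_0[OF that] hom_3[OF ik] that by simp
  qed (use low[OF ik] in auto)
qed

text \<open>
  For \<open>N \<ge> 4\<close> the top coefficients have degree at most 2, which leaves no multiple of the cubic
  \<open>y w\<^sup>2 - t y + 1\<close> except 0.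
\<close>

lemma coeff4_K_eq_0_of_degree_xz_gt_3: "3 < i + k \<Longrightarrow> coeff4 K i j k l = 0"
proof -
  have step: "(\<And>i j k l. N - 1 < i + k \<Longrightarrow> coeff4 K i j k l = 0)"
    if "4 \<le> N" "N \<le> 6" "\<And>i j k l. N < i + k \<Longrightarrow> coeff4 K i j k l = 0" for N
  proof -
    fix i j k l assume ik: "N - 1 < i + k"
    show "coeff4 K i j k l = 0"
    proof (cases "i + k = N")
      case True
      have "coeff4 K i 1 k 2 = 0" using degree_le_6[of i 1 k 2] that(1) True by simp
      then show ?thesis using top_coefficients(1)[OF _ that(2,3) True, of j l] that(1) by auto
    qed (use that(3) ik in auto)
  qed
  have 6: "6 < i + k \<Longrightarrow> coeff4 K i j k l = 0" for i j k l using degree_le_6[of i j k l] by simp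
  have 5: "5 < i + k \<Longrightarrow> coeff4 K i j k l = 0" for i j k l using step[of 6] 6 by simp
  have 4: "4 < i + k \<Longrightarrow> coeff4 K i j k l = 0" for i j k l using step[of 5] 5 by simp
  show "3 < i + k \<Longrightarrow> coeff4 K i j k l = 0" using step[of 4] 4 by simp
qed

end

lemma coeff_1_simps:
  fixes p q :: "'a::comm_ring_1 poly"
  shows "coeff (p * q) 0 = coeff p 0 * coeff q 0"
    and "coeff (p * q) (Suc 0) = coeff p 0 * coeff q (Suc 0) + coeff p (Suc 0) * coeff q 0"
    and "coeff (p ^ n) 0 = coeff p 0 ^ n"
    and "coeff (p ^ n) (Suc 0) = of_nat n * coeff p 0 ^ (n - 1) * coeff p (Suc 0)"
proof -
  show m0: "coeff (p * q) 0 = coeff p 0 * coeff q 0" for p q :: "'a poly"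
    by (simp add: coeff_mult)
  show m1: "coeff (p * q) (Suc 0) = coeff p 0 * coeff q (Suc 0) + coeff p (Suc 0) * coeff q 0"
    for p q :: "'a poly"
    by (simp add: coeff_mult)
  show p0: "coeff (p ^ n) 0 = coeff p 0 ^ n" for n
    by (induction n) (simp_all add: m0)
  show "coeff (p ^ n) (Suc 0) = of_nat n * coeff p 0 ^ (n - 1) * coeff p (Suc 0)"
  proof (induction n)
    case (Suc n)
    then show ?case by (cases n) (simp_all add: m0 m1 p0 algebra_simps)
  qed simp
qed

context regular_hamiltonian
begin

lemma xz_coeff_eq_0: "3 < i + k \<Longrightarrow> xz_coeff i k y w = 0"
  using coeff4_K_eq_0_of_degree_xz_gt_3 by (simp add: xz_coeff_def)

lemma xz_coeff_top:
  assumes "i + k = 3"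
  shows "xz_coeff i k y w = coeff4 K i 1 k 2 * (y * w\<^sup>2 - t * y + 1)"
proof -
  define g where "g = coeff4 K i 1 k 2"
  have c: "coeff4 K i j k l = (if (j, l) \<in> {(0, 0), (1, 2)} then g
      else if (j, l) = (1, 0) then - t * g else 0)" for j l
    unfolding g_def
    by (rule top_coefficients(1)[of 3]) (use coeff4_K_eq_0_of_degree_xz_gt_3 assms in auto)
  have six: "{..6::nat} = {0,1,2,3,4,5,6}" by auto
  show ?thesis
    unfolding g_def[symmetric] unfolding xz_coeff_def six by (simp add: c algebra_simps)
qed

text \<open>
  By \<open>top_coefficients\<close> the part of degree 3 in \<open>x, z\<close> is \<open>y w\<^sup>2 - t y + 1\<close> times
  \<open>x (g\<^sub>1 z\<^sup>2 + g\<^sub>2 x z + g\<^sub>3 x\<^sup>2)\<close>. In the chart \<open>r\<^sub>2\<close>, where \<open>z + x\<close> vanishes along the divisor \<open>w\<^sub>2 = 0\<close>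
  on which the first factor has a triple pole, the cubic form must be divisible by \<open>(z + x)\<^sup>2\<close>; so
  it is a multiple of \<open>x (z + x)\<^sup>2\<close>. In the chart \<open>r\<^sub>1\<close> the first factor is \<open>- (\<alpha>\<^sub>1 + x\<^sub>1 y\<^sub>1) x\<^sub>1 / Y\<close>.
  Its term with \<open>y\<^sub>1\<close> yields a term \<open>x\<^sub>1\<^bsup>-1\<^esup> y\<^sub>1\<close> of \<open>K\<close>, which nothing in the lower
  degrees can cancel, because there \<open>y\<^sub>1\<close> only enters through \<open>Y = c - \<alpha>\<^sub>1 x\<^sub>1 - y\<^sub>1 x\<^sub>1\<^sup>2\<close>.
\<close>

lemma coeff4_K_eq_0_of_degree_xz_gt_2: "2 < i + k \<Longrightarrow> coeff4 K i j k l = 0"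
proof -
  define g where "g i = coeff4 K i 1 (3 - i) 2" for i
  have "coeff4 K 0 1 3 2 = 0"
    by (rule top_coefficients(2)[where i = 0 and k = 3]) (use coeff4_K_eq_0_of_degree_xz_gt_3 in auto)
  then have A3: "xz_coeff 0 3 y w = 0" "xz_coeff 1 2 y w = g 1 * (y * w\<^sup>2 - t * y + 1)"
    "xz_coeff 2 1 y w = g 2 * (y * w\<^sup>2 - t * y + 1)" "xz_coeff 3 0 y w = g 3 * (y * w\<^sup>2 - t * y + 1)" for y w
    by (simp_all add: xz_coeff_top g_def)
  have six: "{..6::nat} = {0,1,2,3,4,5,6}" by auto
  have K: "ev K x y z w = (y * w\<^sup>2 - t * y + 1) * (g 1 * x * z\<^sup>2 + g 2 * x\<^sup>2 * z + g 3 * x ^ 3)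
      + xz_coeff 0 0 y w + xz_coeff 1 0 y w * x + xz_coeff 0 1 y w * z + xz_coeff 2 0 y w * x\<^sup>2
          + xz_coeff 1 1 y w * x * z + xz_coeff 0 2 y w * z\<^sup>2" for x y z w
    unfolding ev_K_xz six by (simp add: xz_coeff_eq_0 A3 algebra_simps del: One_nat_def)

  \<comment> \<open>Third differences isolate the coefficient of \<open>x\<^sup>3\<close>, mixed ones that of \<open>x\<^sup>2 z\<close>, in the chart \<open>r\<^sub>2\<close>
    at \<open>y\<^sub>2 = 0\<close>.\<close>
  define f where "f x z p = ev K2 x 0 z p" for x z p
  have f: "f x z p = ev K x (1 / p) ((a2 - z * p) * p - x) (1 / p)" if "p \<noteq> 0" for x z p
    using regular_r2[OF that, of x 0 z] by (simp add: f_def)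
  have lead: "coeff (smult a [:1, - t, 0, 1:]) 3 = a" for a
    by (simp add: numeral_3_eq_3)
  have "coeff (smult (6 * (g 1 - g 2 + g 3)) [:1, - t, 0, 1:]) 3 = 0"
  proof (rule degree_le_pole_order)
    fix p :: 'a assume p: "p \<noteq> 0"
    show "p ^ 0 * poly (smult (6 * (g 1 - g 2 + g 3)) [:1, - t, 0, 1:]) (1 / p)
        = f 2 0 p - 3 * f 1 0 p + 3 * f 0 0 p - f (- 1) 0 p"
      unfolding f[OF p] K by (simp add: algebra_simps power2_eq_square power3_eq_cube)
  next
    show "polyfun (\<lambda>p. f 2 0 p - 3 * f 1 0 p + 3 * f 0 0 p - f (- 1) 0 p)"
      unfolding f_def by (rule polyfun_if_polyfun2) (intro polyfun2_intros)
  qed simp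
  then have g1: "g 1 - g 2 + g 3 = 0" unfolding lead by (metis mult_eq_0_iff zero_neq_numeral)
  have "coeff (smult (2 * (2 * g 1 - g 2)) [:1, - t, 0, 1:]) 3 = 0"
  proof (rule degree_le_pole_order)
    fix p :: 'a assume p: "p \<noteq> 0"
    show "p\<^sup>2 * poly (smult (2 * (2 * g 1 - g 2)) [:1, - t, 0, 1:]) (1 / p)
        = f 1 1 p - 2 * f 0 1 p + f (- 1) 1 p - (f 1 0 p - 2 * f 0 0 p + f (- 1) 0 p)"
      unfolding f[OF p] K by (simp add: algebra_simps power2_eq_square power3_eq_cube)
  next
    show "polyfun (\<lambda>p. f 1 1 p - 2 * f 0 1 p + f (- 1) 1 p - (f 1 0 p - 2 * f 0 0 p + f (- 1) 0 p))"
      unfolding f_def by (rule polyfun_if_polyfun2) (intro polyfun2_intros)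
  qed simp
  then have "2 * g 1 - g 2 = 0" unfolding lead by (metis mult_eq_0_iff zero_neq_numeral)
  then have g2: "g 2 = 2 * g 1" by simp
  with g1 have g3: "g 3 = g 1" by simp

  \<comment> \<open>In the chart \<open>r\<^sub>1\<close> at \<open>z\<^sub>1 = w\<^sub>1 = 0\<close>, \<open>P y\<close> is \<open>x\<^sub>1\<^sup>2 Y\<^sup>6\<close> times \<open>K + 1 / x\<^sub>1\<close> as a polynomial in \<open>x\<^sub>1\<close>.\<close>
  define Y where "Y y = [:t, - a1, - y:]" for y
  define h where "h i y = (\<Sum>j\<le>6. smult (coeff4 K i j 0 0) (Y y ^ (6 - j)))" for i y
  define X where "X y = ([:0, a0:] - Y y) * Y y" for y
  define P where "P y = smult (- g 1) ([:a1, y:] * ([:0, a0:] - Y y) ^ 3 * Y y ^ 8)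
      + monom 1 2 * h 0 y + [:0, 1:] * X y * h 1 y + (X y)\<^sup>2 * h 2 y + [:0, 1:] * Y y ^ 6" for y
  have "coeff (P y) 1 = 0" for y
  proof (rule poly_vanishing_order[of "{0} \<union> {x. poly (Y y) x = 0}"])
    have "finite {x. poly (Y y) x = 0}"
      using t_nonzero by (intro poly_roots_finite) (simp add: Y_def)
    then show "finite ({0} \<union> {x. poly (Y y) x = 0})" by simp
    show "polyfun (\<lambda>x. poly (Y y) x ^ 6 * ev K1 x y 0 0)"
      by (rule polyfun_if_polyfun2) (intro polyfun2_intros polyfun2_poly)
    fix x assume "x \<notin> {0} \<union> {x. poly (Y y) x = 0}"
    then have x: "x \<noteq> 0" and Yx: "poly (Y y) x \<noteq> 0" by auto
    let ?Y = "poly (Y y) x"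
    have Yeq: "?Y = t - 0\<^sup>2 - (x * y + a1) * x" by (simp add: Y_def algebra_simps)
    have h: "poly (h i y) x = ?Y ^ 6 * xz_coeff i 0 (1 / ?Y) 0" for i
    proof -
      have "xz_coeff_hom i 0 ?Y 0 = poly (h i y) x"
        unfolding xz_coeff_hom_def h_def six by (simp add: poly_sum poly_power)
      then show ?thesis by (simp add: xz_coeff_hom[OF Yx])
    qed
    define X' where "X' = (a0 - ?Y / x) * ?Y"
    have X': "poly (X y) x = x * X'"
      using x by (simp add: X_def X'_def field_simps)
    have "x ^ 3 * X' ^ 3 = (a0 * x - ?Y) ^ 3 * ?Y ^ 3"
      using x by (simp add: X'_def power_mult_distrib[symmetric] field_simps)
    then have X3: "X' ^ 3 = (a0 * x - ?Y) ^ 3 * ?Y ^ 3 / x ^ 3"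
      using x by (simp add: field_simps)
    have e: "1 / ?Y * 0\<^sup>2 - t * (1 / ?Y) + 1 = - (a1 + x * y) * x / ?Y"
      using Yx by (simp add: Yeq field_simps)
    have "x\<^sup>2 * b ^ 6 * (- d * x / b * (g 1 * (v * b ^ 3 / x ^ 3))) = - g 1 * (d * v * b ^ 8)"
      if "b \<noteq> 0" for b d v
      using that x by (simp add: eval_nat_numeral)
    from this[OF Yx, of "a1 + x * y" "(a0 * x - ?Y) ^ 3"]
    have 1: "x\<^sup>2 * ?Y ^ 6 * ((1 / ?Y * 0\<^sup>2 - t * (1 / ?Y) + 1) * (g 1 * X' ^ 3))
        = - g 1 * ((a1 + x * y) * (a0 * x - ?Y) ^ 3 * ?Y ^ 8)"
      unfolding X3 e .
    have "poly (P y) x = - g 1 * ((a1 + x * y) * (a0 * x - ?Y) ^ 3 * ?Y ^ 8)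
        + x\<^sup>2 * (?Y ^ 6 * xz_coeff 0 0 (1 / ?Y) 0)
        + x * (x * X') * (?Y ^ 6 * xz_coeff 1 0 (1 / ?Y) 0) + (x * X')\<^sup>2 * (?Y ^ 6 * xz_coeff 2 0 (1 / ?Y) 0)
            + x * ?Y ^ 6"
      unfolding P_def by (simp add: h X' poly_monom algebra_simps)
    also have "\<dots> = x\<^sup>2 * ?Y ^ 6 * ((1 / ?Y * 0\<^sup>2 - t * (1 / ?Y) + 1) * (g 1 * X' ^ 3)
        + xz_coeff 0 0 (1 / ?Y) 0 + xz_coeff 1 0 (1 / ?Y) 0 * X' + xz_coeff 2 0 (1 / ?Y) 0 * X'\<^sup>2 + 1 / x)"
    proof -
      have "x\<^sup>2 * ?Y ^ 6 * (1 / x) = x * ?Y ^ 6" using x by (simp add: power2_eq_square)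
      then show ?thesis unfolding 1[symmetric] distrib_left
          by (simp add: power_mult_distrib mult_ac power2_eq_square)
    qed
    also have "\<dots> = x\<^sup>2 * ?Y ^ 6 * (ev K X' (1 / ?Y) 0 0 + 1 / x)"
      unfolding K by (simp add: g2 g3)
    also have "\<dots> = x\<^sup>2 * ?Y ^ 6 * ev K1 x y 0 0"
      using regular_r0_r1[OF x Yeq Yx, of 0] by (simp add: X'_def)
    finally show "poly (P y) x = x\<^sup>2 * (?Y ^ 6 * ev K1 x y 0 0)" by simp
  qed simp
  moreover have "coeff (P 1) 1 - coeff (P 0) 1 = g 1 * t ^ 11"
    unfolding P_def h_def X_def six
    by (simp add: Y_def coeff_1_simps coeff_monom_mult) algebra
  ultimately have g1: "g 1 = 0" using t_nonzero by simp

  show "coeff4 K i j k l = 0" if "2 < i + k" for i j k l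
  proof (cases "3 < i + k")
    case False
    then have ik: "i + k = 3" using that by simp
    then have "i = 0 \<or> i = 1 \<or> i = 2 \<or> i = 3" by auto
    moreover have "k = 3 - i" using ik by simp
    then have "coeff4 K i 1 k 2 = g i" by (simp add: g_def)
    moreover have "g 0 = 0" using \<open>coeff4 K 0 1 3 2 = 0\<close> by (simp add: g_def)
    ultimately have gi: "coeff4 K i 1 k 2 = 0" using g1 g2 g3 by auto
    have "coeff4 K i j k l = (if (j, l) \<in> {(0, 0), (1, 2)} then coeff4 K i 1 k 2
      else if (j, l) = (1, 0) then - t * coeff4 K i 1 k 2 else 0)"
      by (rule top_coefficients(1)[of 3]) (use coeff4_K_eq_0_of_degree_xz_gt_3 ik in auto)
    then show ?thesis unfolding gi by simp
  qed (simp add: coeff4_K_eq_0_of_degree_xz_gt_3)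
qed

end

section \<open>Regular Hamiltonians that are quadratic in x and z\<close>

text \<open>
  The normal form of a polynomial that is quadratic in \<open>x, z\<close> and regular in the chart \<open>r\<^sub>0\<close>: with
  \<open>u = x y - \<alpha>\<^sub>0\<close> the functions \<open>x\<close>, \<open>u\<close> and \<open>y u\<close> are, up to sign, \<open>y\<^sub>0 (x\<^sub>0 y\<^sub>0 - \<alpha>\<^sub>0)\<close>, \<open>x\<^sub>0 y\<^sub>0\<close> and
  \<open>x\<^sub>0\<close>, and \<open>K\<close> is a polynomial in them and in \<open>z, w\<close>. In these functions the parameter \<open>\<alpha>\<^sub>0\<close>
  disappears from the leading terms of the equations below. Writing \<open>x\<close> times \<open>y u\<close> as \<open>u\<^sup>2 + \<alpha>\<^sub>0 u\<close>
  makes the representation unique.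
\<close>

locale quadratic_hamiltonian = regular_hamiltonian +
  fixes k A0 A1 A2 A3 B0 B1 B2 B3 B4 B5 B6 B7 B8 :: "'a poly"
  assumes normal_form: "\<And>x y z w. ev K x y z w =
      poly k w * z\<^sup>2
      + (poly A0 w + poly A1 w * x + poly A2 w * (x * y - a0) + poly A3 w * (y * (x * y - a0))) * z
      + poly B0 w + poly B1 w * x + poly B2 w * (x * y - a0) + poly B3 w * (y * (x * y - a0))
      + poly B4 w * x\<^sup>2 + poly B5 w * x * (x * y - a0) + poly B6 w * (x * y - a0)\<^sup>2
      + poly B7 w * y * (x * y - a0)\<^sup>2 + poly B8 w * y\<^sup>2 * (x * y - a0)\<^sup>2"
    and degrees: "degree k \<le> 4" "degree A0 \<le> 5" "degree A1 \<le> 4" "degree A2 \<le> 3" "degree A3 \<le> 2"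
      "degree B0 \<le> 6" "degree B1 \<le> 5" "degree B2 \<le> 4" "degree B3 \<le> 3" "degree B4 \<le> 4"
      "degree B5 \<le> 3" "degree B6 \<le> 2" "degree B7 \<le> 1" "degree B8 \<le> 0"

context regular_hamiltonian
begin

lemma K_normal_form:
  "\<exists>k A0 A1 A2 A3 B0 B1 B2 B3 B4 B5 B6 B7 B8.
    quadratic_hamiltonian t a0 a1 a2 K K0 K1 K2 k A0 A1 A2 A3 B0 B1 B2 B3 B4 B5 B6 B7 B8"
proof -
  define W where "W i j k = (\<Sum>l\<le>6 - i - j - k. monom (coeff4 K i j k l) l)" for i j k
  have deg: "degree (W i j k) \<le> 6 - i - j - k" for i j k
    unfolding W_def by (rule degree_sum_le) (auto intro: order_trans[OF degree_monom_le])
  have poly_W: "poly (W i j k) w = (\<Sum>l\<le>6. coeff4 K i j k l * w ^ l)" for i j k w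
    unfolding W_def poly_sum poly_monom
    by (intro sum.mono_neutral_left) (auto intro: degree_le_6)
  have W: "W 0 j k = 0" if "3 \<le> j" for j k
    using K_r0_relations(1)[OF that] by (simp add: W_def)
  have W': "W 1 j k = 0" if "4 \<le> j" for j k
    using K_r0_relations(2)[OF that] by (simp add: W_def)
  have W'': "W 2 j k = 0" if "5 \<le> j" for j k
    using degree_le_6[of 2 j k] that by (simp add: W_def)
  have W2: "W i j k = 0" if "2 < i + k" for i j k
    using coeff4_K_eq_0_of_degree_xz_gt_2[OF that] by (simp add: W_def)
  have rel: "poly (W 1 3 k) w = - 2 * a0 * poly (W 2 4 k) w"
    "poly (W 0 2 k) w = a0\<^sup>2 * poly (W 2 4 k) w"
    "poly (W 0 1 k) w = - a0 * poly (W 1 2 k) w - a0\<^sup>2 * poly (W 2 3 k) w" for k w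
    unfolding poly_W K_r0_relations(3-5) sum_distrib_left sum_subtractf[symmetric]
    by (intro sum.cong refl; simp add: algebra_simps)+
  have six: "{..6::nat} = {0,1,2,3,4,5,6}" by auto
  have coeff: "xz_coeff i k y w = (\<Sum>j\<le>6. poly (W i j k) w * y ^ j)" for i k y w
    unfolding xz_coeff_def poly_W sum_distrib_right by (simp add: mult_ac)
  have A00: "xz_coeff 0 0 y w = poly (W 0 0 0) w + poly (W 0 1 0) w * y + poly (W 0 2 0) w * y\<^sup>2" for y w
    unfolding coeff six by (simp add: W)
  have A10: "xz_coeff 1 0 y w = poly (W 1 0 0) w + poly (W 1 1 0) w * y + poly (W 1 2 0) w * y\<^sup>2
      + poly (W 1 3 0) w * y ^ 3" for y w
    unfolding coeff six using W'[of 4 0] W'[of 5 0] W'[of 6 0] by (simp del: One_nat_def)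
  have A20: "xz_coeff 2 0 y w = poly (W 2 0 0) w + poly (W 2 1 0) w * y + poly (W 2 2 0) w * y\<^sup>2
      + poly (W 2 3 0) w * y ^ 3
      + poly (W 2 4 0) w * y ^ 4" for y w
    unfolding coeff six by (simp add: W'')
  have A11: "xz_coeff 1 1 y w = poly (W 1 0 1) w + poly (W 1 1 1) w * y + poly (W 1 2 1) w * y\<^sup>2" for y w
    unfolding coeff six using W'[of 4 1] W'[of 5 1] W'[of 6 1] rel(1)[of 1 w] W2[of 2 1 4]
        by (simp del: One_nat_def)
  have A02: "xz_coeff 0 2 y w = poly (W 0 0 2) w" for y w
    unfolding coeff six using rel(2)[of 2 w] rel(3)[of 2 w] by (simp add: W W2 del: One_nat_def)
  have r: "poly (W 0 1 1) w = - a0 * poly (W 1 2 1) w" for w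
    using rel(3)[of 1 w] by (simp add: W2 del: One_nat_def)
  have A01: "xz_coeff 0 1 y w = poly (W 0 0 1) w - a0 * poly (W 1 2 1) w * y" for y w
    unfolding coeff six using rel(2)[of 1 w] W2[of 2 1 4] r[of w] by (simp add: W del: One_nat_def)
  have K: "ev K x y z w = xz_coeff 0 0 y w + xz_coeff 1 0 y w * x + xz_coeff 2 0 y w * x\<^sup>2
      + xz_coeff 0 1 y w * z + xz_coeff 1 1 y w * x * z + xz_coeff 0 2 y w * z\<^sup>2"
    for x y z w
  proof -
    have "xz_coeff i k y w = 0" if "2 < i + k" for i k
      using W2[OF that] by (simp add: coeff)
    then show ?thesis unfolding ev_K_xz six by (simp add: algebra_simps)
  qed
  have "quadratic_hamiltonian t a0 a1 a2 K K0 K1 K2 (W 0 0 2)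
      (W 0 0 1 + smult a0 (W 1 1 1)) (W 1 0 1) (W 1 1 1) (W 1 2 1)
      (W 0 0 0 + smult a0 (W 1 1 0) + smult (a0\<^sup>2) (W 2 2 0)) (W 1 0 0 + smult a0 (W 2 1 0))
      (W 1 1 0 + smult (2 * a0) (W 2 2 0)) (W 1 2 0 + smult (2 * a0) (W 2 3 0))
      (W 2 0 0) (W 2 1 0) (W 2 2 0) (W 2 3 0) (W 2 4 0)"
  proof (unfold_locales)
    fix x y z w
    show "ev K x y z w =
      poly (W 0 0 2) w * z\<^sup>2
      + (poly (W 0 0 1 + smult a0 (W 1 1 1)) w + poly (W 1 0 1) w * x + poly (W 1 1 1) w * (x * y - a0)
        + poly (W 1 2 1) w * (y * (x * y - a0))) * z
      + poly (W 0 0 0 + smult a0 (W 1 1 0) + smult (a0\<^sup>2) (W 2 2 0)) w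
          + poly (W 1 0 0 + smult a0 (W 2 1 0)) w * x
      + poly (W 1 1 0 + smult (2 * a0) (W 2 2 0)) w * (x * y - a0)
      + poly (W 1 2 0 + smult (2 * a0) (W 2 3 0)) w * (y * (x * y - a0))
      + poly (W 2 0 0) w * x\<^sup>2 + poly (W 2 1 0) w * x * (x * y - a0) + poly (W 2 2 0) w * (x * y - a0)\<^sup>2
      + poly (W 2 3 0) w * y * (x * y - a0)\<^sup>2 + poly (W 2 4 0) w * y\<^sup>2 * (x * y - a0)\<^sup>2"
      unfolding K A00 A10 A20 A01 A11 A02 rel poly_add poly_smult by algebra
  qed (use deg[of 0 0 2] deg[of 0 0 1] deg[of 1 1 1] deg[of 1 0 1] deg[of 1 2 1] deg[of 0 0 0]
      deg[of 1 1 0] deg[of 2 2 0] deg[of 1 0 0] deg[of 2 1 0] deg[of 1 2 0] deg[of 2 3 0]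
      deg[of 2 0 0] deg[of 2 4 0] in \<open>auto simp del: One_nat_def intro!: degree_add_le
          order_trans[OF degree_smult_le]\<close>)
  then show ?thesis by blast
qed

end

context quadratic_hamiltonian
begin

text \<open>
  In the chart \<open>r\<^sub>1\<close> at \<open>y\<^sub>1 = 0\<close> the functions \<open>x\<close>, \<open>u\<close>, \<open>y u\<close> and \<open>z\<close> have simple poles along
  \<open>x\<^sub>1 = 0\<close>. So \<open>x\<^sub>1\<^sup>2 (K + x\<^sub>0)\<close> is a polynomial in \<open>x\<^sub>1\<close>, and the three equations are the vanishing of
  its coefficients of \<open>1\<close>, of \<open>x\<^sub>1 z\<^sub>1\<close> and of \<open>x\<^sub>1\<close>. The summand 1 in the last one comes from
  \<open>x\<^sub>0 = 1 / x\<^sub>1\<close>.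
\<close>

lemma r1_equations_pointwise:
  assumes c: "t - w\<^sup>2 \<noteq> 0"
  defines "c \<equiv> t - w\<^sup>2"
  shows "4 * w\<^sup>2 * poly k w - 2 * w * (c\<^sup>2 * poly A1 w + c * poly A2 w + poly A3 w)
      + c ^ 4 * poly B4 w + c ^ 3 * poly B5 w + c\<^sup>2 * poly B6 w + c * poly B7 w + poly B8 w = 0"
    and "4 * w * poly k w - c\<^sup>2 * poly A1 w - c * poly A2 w - poly A3 w = 0"
    and "2 * w * (poly A0 w + (a0 + 2 * a1) * c * poly A1 w + a1 * poly A2 w)
      - c\<^sup>2 * poly B1 w - c * poly B2 w - poly B3 w - 2 * (a0 + 2 * a1) * c ^ 3 * poly B4 w
      - (a0 + 3 * a1) * c\<^sup>2 * poly B5 w - 2 * a1 * c * poly B6 w - a1 * poly B7 w + 1 = 0"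
proof -
  define Y where "Y = [:c, - a1:]"
  define X where "X = [:- c, a0 + a1:] * Y"
  define P where "P z = smult (poly k w) ([:2 * w, z:]\<^sup>2)
    + [:2 * w, z:] * ([:0, poly A0 w:] + smult (poly A1 w) X - smult (poly A2 w) Y - [:poly A3 w:])
    + [:0, 0, poly B0 w:] + [:0, 1:] * (smult (poly B1 w) X - smult (poly B2 w) Y - [:poly B3 w:])
    + smult (poly B4 w) (X\<^sup>2) - smult (poly B5 w) (X * Y) + smult (poly B6 w) (Y\<^sup>2) + smult (poly B7 w) Y
    + [:poly B8 w, 1:]" for z
  have van: "coeff (P z) j = 0" if "j < 2" for z j
  proof (rule poly_vanishing_order[of "{0} \<union> {x. poly Y x = 0}"])
    have "finite {x. poly Y x = 0}"
      using c by (intro poly_roots_finite) (simp add: Y_def c_def)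
    then show "finite ({0} \<union> {x. poly Y x = 0})" by simp
    show "polyfun (\<lambda>x. ev K1 x 0 z w)"
      by (rule polyfun_if_polyfun2) (intro polyfun2_intros)
    fix x assume "x \<notin> {0} \<union> {x. poly Y x = 0}"
    then have x: "x \<noteq> 0" and Yx: "poly Y x \<noteq> 0" by auto
    let ?Y = "poly Y x"
    define b where "b = ?Y"
    have b0: "b \<noteq> 0" using Yx by (simp add: b_def)
    have Yeq: "?Y = t - w\<^sup>2 - (x * 0 + a1) * x" by (simp add: Y_def c_def algebra_simps)
    have X: "poly X x = (a0 * x - b) * b" by (simp add: X_def b_def[symmetric])
        (simp add: Y_def b_def algebra_simps)
    have u: "(a0 - b / x) * b * (1 / b) - a0 = - b / x" using b0 by simp
    have s: "1 / b * (- b / x) = - 1 / x" using b0 by simp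
    have s2: "1 / b * (- b / x)\<^sup>2 = b / x\<^sup>2" "(1 / b)\<^sup>2 * (- b / x)\<^sup>2 = 1 / x\<^sup>2"
      using b0 by (simp_all add: power2_eq_square)
    have xx: "x * ((a0 - b / x) * b) = (a0 * x - b) * b" "x * (z + 2 * w / x) = 2 * w + x * z"
      using x by (simp_all add: field_simps)
    have "x\<^sup>2 * (ev K ((a0 - b / x) * b) (1 / b) (z + 2 * w / x) w + 1 / x)
        = poly k w * (x * (z + 2 * w / x))\<^sup>2
          + (x * (z + 2 * w / x)) * (x * poly A0 w + poly A1 w * (x * ((a0 - b / x) * b)) - poly A2 w * b
              - poly A3 w)
          + x\<^sup>2 * poly B0 w + x * (poly B1 w * (x * ((a0 - b / x) * b)) - poly B2 w * b - poly B3 w)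
          + poly B4 w * (x * ((a0 - b / x) * b))\<^sup>2 - poly B5 w * (x * ((a0 - b / x) * b)) * b
          + poly B6 w * b\<^sup>2 + poly B7 w * b + poly B8 w + x"
    proof -
      have g: "x\<^sup>2 * (kk * Z\<^sup>2 + (q0 + q1 * X' + q2 * (- b / x) + q3 * (- 1 / x)) * Z
            + r0 + r1 * X' + r2 * (- b / x) + r3 * (- 1 / x) + r4 * X'\<^sup>2 + r5 * X' * (- b / x)
                + r6 * (- b / x)\<^sup>2
            + r7 * (b / x\<^sup>2) + r8 * (1 / x\<^sup>2) + 1 / x)
          = kk * (x * Z)\<^sup>2 + (x * Z) * (x * q0 + q1 * (x * X') - q2 * b - q3) + x\<^sup>2 * r0
            + x * (r1 * (x * X') - r2 * b - r3) + r4 * (x * X')\<^sup>2 - r5 * (x * X') * b + r6 * b\<^sup>2 + r7 * b + r8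
                + x"
        for kk Z q0 q1 q2 q3 X' r0 r1 r2 r3 r4 r5 r6 r7 r8
        using x by (simp add: field_simps power2_eq_square)
      show ?thesis
        unfolding normal_form u s mult.assoc[of _ "1 / b"] mult.assoc[of _ "(1 / b)\<^sup>2"] s2 g ..
    qed
    then have "poly (P z) x = x\<^sup>2 * (ev K ((a0 - b / x) * b) (1 / b) (z + 2 * w / x) w + 1 / x)"
      unfolding xx by (simp add: P_def X b_def[symmetric] algebra_simps power2_eq_square)
    also have "\<dots> = x\<^sup>2 * ev K1 x 0 z w"
      using regular_r0_r1[OF x Yeq Yx, of z] by (simp add: b_def)
    finally show "poly (P z) x = x\<^sup>2 * ev K1 x 0 z w" .
  qed (use that in simp)
  have coeffs: "coeff (P z) 0 = 4 * w\<^sup>2 * poly k w - 2 * w * (c\<^sup>2 * poly A1 w + c * poly A2 w + poly A3 w)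
      + c ^ 4 * poly B4 w + c ^ 3 * poly B5 w + c\<^sup>2 * poly B6 w + c * poly B7 w + poly B8 w"
    "coeff (P z) (Suc 0) = z * (4 * w * poly k w - c\<^sup>2 * poly A1 w - c * poly A2 w - poly A3 w)
      + (2 * w * (poly A0 w + (a0 + 2 * a1) * c * poly A1 w + a1 * poly A2 w)
      - c\<^sup>2 * poly B1 w - c * poly B2 w - poly B3 w - 2 * (a0 + 2 * a1) * c ^ 3 * poly B4 w
      - (a0 + 3 * a1) * c\<^sup>2 * poly B5 w - 2 * a1 * c * poly B6 w - a1 * poly B7 w + 1)" for z
    unfolding P_def X_def Y_def by (simp_all add: coeff_1_simps) algebra+
  show "4 * w\<^sup>2 * poly k w - 2 * w * (c\<^sup>2 * poly A1 w + c * poly A2 w + poly A3 w)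
      + c ^ 4 * poly B4 w + c ^ 3 * poly B5 w + c\<^sup>2 * poly B6 w + c * poly B7 w + poly B8 w = 0"
    using van[of 0 0] coeffs(1)[of 0] by simp
  show 3: "2 * w * (poly A0 w + (a0 + 2 * a1) * c * poly A1 w + a1 * poly A2 w)
      - c\<^sup>2 * poly B1 w - c * poly B2 w - poly B3 w - 2 * (a0 + 2 * a1) * c ^ 3 * poly B4 w
      - (a0 + 3 * a1) * c\<^sup>2 * poly B5 w - 2 * a1 * c * poly B6 w - a1 * poly B7 w + 1 = 0"
    using van[of 1 0] coeffs(2)[of 0] by simp
  show "4 * w * poly k w - c\<^sup>2 * poly A1 w - c * poly A2 w - poly A3 w = 0"
    using van[of 1 1] coeffs(2)[of 1] unfolding 3 by simp
qed

end

section \<open>The linear equations for the coefficients\<close>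

text \<open>
  The parametric form of the pole criterion: the coefficients of \<open>Q\<close>, a polynomial in \<open>w\<close>, are
  polynomials in \<open>y\<close>, and the pole at \<open>w = \<infinity>\<close> is bounded for every fixed \<open>y\<close>.
\<close>

lemma degree_le_pole_order_parametric:
  fixes Q :: "'a::field_char_0 poly poly"
  assumes "\<And>y p. p \<noteq> 0 \<Longrightarrow> p ^ m * poly (poly Q [:1 / p:]) y = g y p" "\<And>y. polyfun (g y)"
  shows "\<forall>d>m. coeff Q d = 0"
proof (intro allI impI)
  fix d assume d: "m < d"
  have "poly (coeff Q d) y = 0" for y
  proof -
    have ev: "poly (map_poly (\<lambda>q. poly q y) Q) v = poly (poly Q [:v:]) y" for v
      by (induction Q) (simp_all add: map_poly_pCons)
    have "coeff (map_poly (\<lambda>q. poly q y) Q) d = 0"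
      by (rule degree_le_pole_order[OF _ assms(2) d]) (simp add: ev assms(1))
    then show ?thesis by (simp add: coeff_map_poly)
  qed
  then show "coeff Q d = 0" by (intro poly_eqI_cofinite[of "{}"]) auto
qed

lemma coeffs_above_pCons:
  "(\<forall>d>0. coeff (pCons a q) d = 0) \<longleftrightarrow> q = 0"
  "(\<forall>d>Suc m. coeff (pCons a q) d = 0) \<longleftrightarrow> (\<forall>d>m. coeff q d = 0)"
proof -
  have "(\<forall>d>m. coeff (pCons a q) d = 0) \<longleftrightarrow> (\<forall>d\<ge>m. coeff q d = 0)" for m
    by (auto simp: coeff_pCons split: nat.splits)
  then show "(\<forall>d>0. coeff (pCons a q) d = 0) \<longleftrightarrow> q = 0"
    "(\<forall>d>Suc m. coeff (pCons a q) d = 0) \<longleftrightarrow> (\<forall>d>m. coeff q d = 0)"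
    by (auto simp: poly_eq_iff Suc_le_eq)
qed

context quadratic_hamiltonian
begin

abbreviation "k' \<equiv> coeff k"
abbreviation "A0' \<equiv> coeff A0"
abbreviation "A1' \<equiv> coeff A1"
abbreviation "A2' \<equiv> coeff A2"
abbreviation "A3' \<equiv> coeff A3"
abbreviation "B0' \<equiv> coeff B0"
abbreviation "B1' \<equiv> coeff B1"
abbreviation "B2' \<equiv> coeff B2"
abbreviation "B3' \<equiv> coeff B3"
abbreviation "B4' \<equiv> coeff B4"
abbreviation "B5' \<equiv> coeff B5"
abbreviation "B6' \<equiv> coeff B6"
abbreviation "B7' \<equiv> coeff B7"
abbreviation "B8' \<equiv> coeff B8"

lemma coefficient_expansions:
  shows "poly k v = k' 0 + k' 1 * v + k' 2 * v\<^sup>2 + k' 3 * v ^ 3 + k' 4 * v ^ 4"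
    and "poly A0 v = A0' 0 + A0' 1 * v + A0' 2 * v\<^sup>2 + A0' 3 * v ^ 3 + A0' 4 * v ^ 4
      + A0' 5 * v ^ 5"
    and "poly A1 v = A1' 0 + A1' 1 * v + A1' 2 * v\<^sup>2 + A1' 3 * v ^ 3 + A1' 4 * v ^ 4"
    and "poly A2 v = A2' 0 + A2' 1 * v + A2' 2 * v\<^sup>2 + A2' 3 * v ^ 3"
    and "poly A3 v = A3' 0 + A3' 1 * v + A3' 2 * v\<^sup>2"
    and "poly B0 v = B0' 0 + B0' 1 * v + B0' 2 * v\<^sup>2 + B0' 3 * v ^ 3 + B0' 4 * v ^ 4
      + B0' 5 * v ^ 5 + B0' 6 * v ^ 6"
    and "poly B1 v = B1' 0 + B1' 1 * v + B1' 2 * v\<^sup>2 + B1' 3 * v ^ 3 + B1' 4 * v ^ 4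
      + B1' 5 * v ^ 5"
    and "poly B2 v = B2' 0 + B2' 1 * v + B2' 2 * v\<^sup>2 + B2' 3 * v ^ 3 + B2' 4 * v ^ 4"
    and "poly B3 v = B3' 0 + B3' 1 * v + B3' 2 * v\<^sup>2 + B3' 3 * v ^ 3"
    and "poly B4 v = B4' 0 + B4' 1 * v + B4' 2 * v\<^sup>2 + B4' 3 * v ^ 3 + B4' 4 * v ^ 4"
    and "poly B5 v = B5' 0 + B5' 1 * v + B5' 2 * v\<^sup>2 + B5' 3 * v ^ 3"
    and "poly B6 v = B6' 0 + B6' 1 * v + B6' 2 * v\<^sup>2"
    and "poly B7 v = B7' 0 + B7' 1 * v"
    and "poly B8 v = B8' 0"
proof -
  have e: "poly p v = (\<Sum>i\<le>n. coeff p i * v ^ i)" if "degree p \<le> n" for p :: "'a poly" and n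
    by (rule poly_as_sum_upto) (use that in \<open>auto intro: coeff_eq_0\<close>)
  have s: "{..0::nat} = {0}" "{..1::nat} = {0, 1}" "{..2::nat} = {0, 1, 2}" "{..3::nat} = {0, 1, 2, 3}"
    "{..4::nat} = {0, 1, 2, 3, 4}" "{..5::nat} = {0, 1, 2, 3, 4, 5}" "{..6::nat} = {0, 1, 2, 3, 4, 5, 6}"
    by auto
  show "poly k v = k' 0 + k' 1 * v + k' 2 * v\<^sup>2 + k' 3 * v ^ 3 + k' 4 * v ^ 4"
    using e[OF degrees(1)] unfolding s by simp
  show "poly A0 v = A0' 0 + A0' 1 * v + A0' 2 * v\<^sup>2 + A0' 3 * v ^ 3 + A0' 4 * v ^ 4
      + A0' 5 * v ^ 5"
    using e[OF degrees(2)] unfolding s by simp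
  show "poly A1 v = A1' 0 + A1' 1 * v + A1' 2 * v\<^sup>2 + A1' 3 * v ^ 3 + A1' 4 * v ^ 4"
    using e[OF degrees(3)] unfolding s by simp
  show "poly A2 v = A2' 0 + A2' 1 * v + A2' 2 * v\<^sup>2 + A2' 3 * v ^ 3"
    using e[OF degrees(4)] unfolding s by simp
  show "poly A3 v = A3' 0 + A3' 1 * v + A3' 2 * v\<^sup>2"
    using e[OF degrees(5)] unfolding s by simp
  show "poly B0 v = B0' 0 + B0' 1 * v + B0' 2 * v\<^sup>2 + B0' 3 * v ^ 3 + B0' 4 * v ^ 4
      + B0' 5 * v ^ 5 + B0' 6 * v ^ 6"
    using e[OF degrees(6)] unfolding s by simp
  show "poly B1 v = B1' 0 + B1' 1 * v + B1' 2 * v\<^sup>2 + B1' 3 * v ^ 3 + B1' 4 * v ^ 4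
      + B1' 5 * v ^ 5"
    using e[OF degrees(7)] unfolding s by simp
  show "poly B2 v = B2' 0 + B2' 1 * v + B2' 2 * v\<^sup>2 + B2' 3 * v ^ 3 + B2' 4 * v ^ 4"
    using e[OF degrees(8)] unfolding s by simp
  show "poly B3 v = B3' 0 + B3' 1 * v + B3' 2 * v\<^sup>2 + B3' 3 * v ^ 3"
    using e[OF degrees(9)] unfolding s by simp
  show "poly B4 v = B4' 0 + B4' 1 * v + B4' 2 * v\<^sup>2 + B4' 3 * v ^ 3 + B4' 4 * v ^ 4"
    using e[OF degrees(10)] unfolding s by simp
  show "poly B5 v = B5' 0 + B5' 1 * v + B5' 2 * v\<^sup>2 + B5' 3 * v ^ 3"
    using e[OF degrees(11)] unfolding s by simp
  show "poly B6 v = B6' 0 + B6' 1 * v + B6' 2 * v\<^sup>2"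
    using e[OF degrees(12)] unfolding s by simp
  show "poly B7 v = B7' 0 + B7' 1 * v"
    using e[OF degrees(13)] unfolding s by simp
  show "poly B8 v = B8' 0"
    using e[OF degrees(14)] unfolding s by simp
qed

text \<open>
  The next three lemmas compare the coefficients of the powers of \<open>w\<close> in the three identities of
  \<open>r1_equations_pointwise\<close>. Of the resulting equations they keep those from which the linear system
  is solved below.
\<close>

lemma r1_equations_const:
  shows "t ^ 4 * B4' 0 + t ^ 3 * B5' 0 + t\<^sup>2 * B6' 0 + t * B7' 0 + B8' 0 = 0" (is "?r0 = 0")
    and "t ^ 4 * B4' 2 - 2 * t\<^sup>2 * A1' 1 - 2 * t * A2' 1 - 2 * A3' 1 - 4 * t ^ 3 * B4' 0
      - 3 * t\<^sup>2 * B5' 0 + t ^ 3 * B5' 2 - 2 * t * B6' 0 + t\<^sup>2 * B6' 2 - B7' 0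
      + 4 * k' 0 = 0" (is "?r2 = 0")
    and "4 * t * A1' 1 - 2 * t\<^sup>2 * A1' 3 + 2 * A2' 1 - 2 * t * A2' 3 + 6 * t\<^sup>2 * B4' 0
      - 4 * t ^ 3 * B4' 2 + t ^ 4 * B4' 4 + 3 * t * B5' 0 - 3 * t\<^sup>2 * B5' 2 + B6' 0
      - 2 * t * B6' 2 + 4 * k' 2 = 0" (is "?r4 = 0")
    and "4 * t * A1' 2 - 2 * A1' 0 - 2 * t\<^sup>2 * A1' 4 + 2 * A2' 2 + 6 * t\<^sup>2 * B4' 1
      - 4 * t ^ 3 * B4' 3 + 3 * t * B5' 1 - 3 * t\<^sup>2 * B5' 3 + B6' 1
      + 4 * k' 3 = 0" (is "?r5 = 0")
    and "4 * t * A1' 3 - 2 * A1' 1 + 2 * A2' 3 - 4 * t * B4' 0 + 6 * t\<^sup>2 * B4' 2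
      - 4 * t ^ 3 * B4' 4 - B5' 0 + 3 * t * B5' 2 + B6' 2 + 4 * k' 4 = 0" (is "?r6 = 0")
    and "4 * t * A1' 4 - 2 * A1' 2 - 4 * t * B4' 1 + 6 * t\<^sup>2 * B4' 3 - B5' 1
      + 3 * t * B5' 3 = 0" (is "?r7 = 0")
    and "B4' 0 - 2 * A1' 3 - 4 * t * B4' 2 + 6 * t\<^sup>2 * B4' 4 - B5' 2 = 0" (is "?r8 = 0")
    and "B4' 1 - 2 * A1' 4 - 4 * t * B4' 3 - B5' 3 = 0" (is "?r9 = 0")
    and "B4' 2 - 4 * t * B4' 4 = 0" (is "?r10 = 0")
    and "B4' 3 = 0" (is "?r11 = 0")
    and "B4' 4 = 0" (is "?r12 = 0")
proof -
  have "[:?r0, t ^ 4 * B4' 1 - 2 * t\<^sup>2 * A1' 0 - 2 * t * A2' 0 - 2 * A3' 0 + t ^ 3 * B5' 1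
      + t\<^sup>2 * B6' 1 + t * B7' 1, ?r2, 4 * t * A1' 0 - 2 * t\<^sup>2 * A1' 2 + 2 * A2' 0
      - 2 * t * A2' 2 - 2 * A3' 2 - 4 * t ^ 3 * B4' 1 + t ^ 4 * B4' 3 - 3 * t\<^sup>2 * B5' 1
      + t ^ 3 * B5' 3 - 2 * t * B6' 1 - B7' 1 + 4 * k' 1, ?r4, ?r5, ?r6, ?r7, ?r8, ?r9, ?r10, ?r11,
      ?r12:] = 0" (is "?P = 0")
  proof (rule poly_eqI_cofinite)
    show "finite {w. poly [:t, 0, - 1:] w = 0}" by (rule poly_roots_finite) simp
  next
    fix w assume "w \<notin> {w. poly [:t, 0, - 1:] w = 0}"
    then have c: "t - w\<^sup>2 \<noteq> 0" by (simp add: power2_eq_square)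
    have "poly ?P w = 4 * w\<^sup>2 * poly k w - 2 * w * ((t - w\<^sup>2)\<^sup>2 * poly A1 w + (t - w\<^sup>2) * poly A2 w + poly A3 w)
        + (t - w\<^sup>2) ^ 4 * poly B4 w + (t - w\<^sup>2) ^ 3 * poly B5 w + (t - w\<^sup>2)\<^sup>2 * poly B6 w
        + (t - w\<^sup>2) * poly B7 w + poly B8 w"
      unfolding poly_pCons poly_0 coefficient_expansions by algebra
    also have "\<dots> = 0" by (rule r1_equations_pointwise(1)[OF c])
    finally show "poly ?P w = poly 0 w" by simp
  qed
  then show "?r0 = 0" "?r2 = 0" "?r4 = 0" "?r5 = 0" "?r6 = 0" "?r7 = 0" "?r8 = 0" "?r9 = 0" "?r10 = 0" "?r11
      = 0" "?r12 = 0"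
    unfolding pCons_eq_0_iff by blast+
qed

lemma r1_equations_z:
  shows "- (t\<^sup>2 * A1' 0) - t * A2' 0 - A3' 0 = 0" (is "?r0 = 0")
    and "4 * k' 0 - t\<^sup>2 * A1' 1 - t * A2' 1 - A3' 1 = 0" (is "?r1 = 0")
    and "2 * t * A1' 0 - t\<^sup>2 * A1' 2 + A2' 0 - t * A2' 2 - A3' 2
      + 4 * k' 1 = 0" (is "?r2 = 0")
    and "2 * t * A1' 1 - t\<^sup>2 * A1' 3 + A2' 1 - t * A2' 3 + 4 * k' 2 = 0" (is "?r3 = 0")
    and "2 * t * A1' 2 - A1' 0 - t\<^sup>2 * A1' 4 + A2' 2 + 4 * k' 3 = 0" (is "?r4 = 0")
    and "2 * t * A1' 3 - A1' 1 + A2' 3 + 4 * k' 4 = 0" (is "?r5 = 0")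
    and "2 * t * A1' 4 - A1' 2 = 0" (is "?r6 = 0")
    and "- (A1' 3) = 0" (is "?r7 = 0")
    and "- (A1' 4) = 0" (is "?r8 = 0")
proof -
  have "[:?r0, ?r1, ?r2, ?r3, ?r4, ?r5, ?r6, ?r7, ?r8:] = 0" (is "?P = 0")
  proof (rule poly_eqI_cofinite)
    show "finite {w. poly [:t, 0, - 1:] w = 0}" by (rule poly_roots_finite) simp
  next
    fix w assume "w \<notin> {w. poly [:t, 0, - 1:] w = 0}"
    then have c: "t - w\<^sup>2 \<noteq> 0" by (simp add: power2_eq_square)
    have "poly ?P w = 4 * w * poly k w - (t - w\<^sup>2)\<^sup>2 * poly A1 w - (t - w\<^sup>2) * poly A2 w - poly A3 w"
      unfolding poly_pCons poly_0 coefficient_expansions by algebra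
    also have "\<dots> = 0" by (rule r1_equations_pointwise(2)[OF c])
    finally show "poly ?P w = poly 0 w" by simp
  qed
  then show "?r0 = 0" "?r1 = 0" "?r2 = 0" "?r3 = 0" "?r4 = 0" "?r5 = 0" "?r6 = 0" "?r7 = 0" "?r8 = 0"
    unfolding pCons_eq_0_iff by blast+
qed

lemma r1_equations_linear:
  shows "1 - t\<^sup>2 * B1' 0 - t * B2' 0 - B3' 0 - 2 * t ^ 3 * a0 * B4' 0 - 4 * t ^ 3 * a1 * B4' 0
      - t\<^sup>2 * a0 * B5' 0 - 3 * t\<^sup>2 * a1 * B5' 0 - 2 * t * a1 * B6' 0
      - a1 * B7' 0 = 0" (is "?r0 = 0")
    and "2 * A0' 0 + 2 * t * a0 * A1' 0 + 4 * t * a1 * A1' 0 + 2 * a1 * A2' 0 - t\<^sup>2 * B1' 1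
      - t * B2' 1 - B3' 1 - 2 * t ^ 3 * a0 * B4' 1 - 4 * t ^ 3 * a1 * B4' 1 - t\<^sup>2 * a0 * B5' 1
      - 3 * t\<^sup>2 * a1 * B5' 1 - 2 * t * a1 * B6' 1 - a1 * B7' 1 = 0" (is "?r1 = 0")
    and "2 * A0' 1 + 2 * t * a0 * A1' 1 + 4 * t * a1 * A1' 1 + 2 * a1 * A2' 1 + 2 * t * B1' 0
      - t\<^sup>2 * B1' 2 + B2' 0 - t * B2' 2 - B3' 2 + 6 * t\<^sup>2 * a0 * B4' 0
      + 12 * t\<^sup>2 * a1 * B4' 0 - 2 * t ^ 3 * a0 * B4' 2 - 4 * t ^ 3 * a1 * B4' 2
      + 2 * t * a0 * B5' 0 + 6 * t * a1 * B5' 0 - t\<^sup>2 * a0 * B5' 2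
      - 3 * t\<^sup>2 * a1 * B5' 2 + 2 * a1 * B6' 0 - 2 * t * a1 * B6' 2 = 0" (is "?r2 = 0")
    and "2 * A0' 2 - 2 * a0 * A1' 0 - 4 * a1 * A1' 0 + 2 * t * a0 * A1' 2 + 4 * t * a1 * A1' 2
      + 2 * a1 * A2' 2 + 2 * t * B1' 1 - t\<^sup>2 * B1' 3 + B2' 1 - t * B2' 3 - B3' 3
      + 6 * t\<^sup>2 * a0 * B4' 1 + 12 * t\<^sup>2 * a1 * B4' 1 - 2 * t ^ 3 * a0 * B4' 3
      - 4 * t ^ 3 * a1 * B4' 3 + 2 * t * a0 * B5' 1 + 6 * t * a1 * B5' 1 - t\<^sup>2 * a0 * B5' 3
      - 3 * t\<^sup>2 * a1 * B5' 3 + 2 * a1 * B6' 1 = 0" (is "?r3 = 0")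
    and "2 * A0' 3 - 2 * a0 * A1' 1 - 4 * a1 * A1' 1 + 2 * t * a0 * A1' 3 + 4 * t * a1 * A1' 3
      + 2 * a1 * A2' 3 - B1' 0 + 2 * t * B1' 2 - t\<^sup>2 * B1' 4 + B2' 2 - t * B2' 4
      - 6 * t * a0 * B4' 0 - 12 * t * a1 * B4' 0 + 6 * t\<^sup>2 * a0 * B4' 2
      + 12 * t\<^sup>2 * a1 * B4' 2 - 2 * t ^ 3 * a0 * B4' 4 - 4 * t ^ 3 * a1 * B4' 4 - a0 * B5' 0
      - 3 * a1 * B5' 0 + 2 * t * a0 * B5' 2 + 6 * t * a1 * B5' 2
      + 2 * a1 * B6' 2 = 0" (is "?r4 = 0")
    and "2 * A0' 4 - 2 * a0 * A1' 2 - 4 * a1 * A1' 2 + 2 * t * a0 * A1' 4 + 4 * t * a1 * A1' 4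
      - B1' 1 + 2 * t * B1' 3 - t\<^sup>2 * B1' 5 + B2' 3 - 6 * t * a0 * B4' 1 - 12 * t * a1 * B4' 1
      + 6 * t\<^sup>2 * a0 * B4' 3 + 12 * t\<^sup>2 * a1 * B4' 3 - a0 * B5' 1 - 3 * a1 * B5' 1
      + 2 * t * a0 * B5' 3 + 6 * t * a1 * B5' 3 = 0" (is "?r5 = 0")
    and "2 * A0' 5 - 2 * a0 * A1' 3 - 4 * a1 * A1' 3 - B1' 2 + 2 * t * B1' 4 + B2' 4
      + 2 * a0 * B4' 0 + 4 * a1 * B4' 0 - 6 * t * a0 * B4' 2 - 12 * t * a1 * B4' 2
      + 6 * t\<^sup>2 * a0 * B4' 4 + 12 * t\<^sup>2 * a1 * B4' 4 - a0 * B5' 2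
      - 3 * a1 * B5' 2 = 0" (is "?r6 = 0")
    and "2 * t * B1' 5 - 2 * a0 * A1' 4 - 4 * a1 * A1' 4 - B1' 3 + 2 * a0 * B4' 1 + 4 * a1 * B4' 1
      - 6 * t * a0 * B4' 3 - 12 * t * a1 * B4' 3 - a0 * B5' 3 - 3 * a1 * B5' 3 = 0" (is "?r7 = 0")
    and "2 * a0 * B4' 2 - B1' 4 + 4 * a1 * B4' 2 - 6 * t * a0 * B4' 4
      - 12 * t * a1 * B4' 4 = 0" (is "?r8 = 0")
    and "2 * a0 * B4' 3 - B1' 5 + 4 * a1 * B4' 3 = 0" (is "?r9 = 0")
proof -
  have "[:?r0, ?r1, ?r2, ?r3, ?r4, ?r5, ?r6, ?r7, ?r8, ?r9, 2 * a0 * B4' 4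
      + 4 * a1 * B4' 4:] = 0" (is "?P = 0")
  proof (rule poly_eqI_cofinite)
    show "finite {w. poly [:t, 0, - 1:] w = 0}" by (rule poly_roots_finite) simp
  next
    fix w assume "w \<notin> {w. poly [:t, 0, - 1:] w = 0}"
    then have c: "t - w\<^sup>2 \<noteq> 0" by (simp add: power2_eq_square)
    have "poly ?P w = 2 * w * (poly A0 w + (a0 + 2 * a1) * (t - w\<^sup>2) * poly A1 w + a1 * poly A2 w)
        - (t - w\<^sup>2)\<^sup>2 * poly B1 w - (t - w\<^sup>2) * poly B2 w - poly B3 w
        - 2 * (a0 + 2 * a1) * (t - w\<^sup>2) ^ 3 * poly B4 w - (a0 + 3 * a1) * (t - w\<^sup>2)\<^sup>2 * poly B5 w
        - 2 * a1 * (t - w\<^sup>2) * poly B6 w - a1 * poly B7 w + 1"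
      unfolding poly_pCons poly_0 coefficient_expansions by algebra
    also have "\<dots> = 0" by (rule r1_equations_pointwise(3)[OF c])
    finally show "poly ?P w = poly 0 w" by simp
  qed
  then show "?r0 = 0" "?r1 = 0" "?r2 = 0" "?r3 = 0" "?r4 = 0" "?r5 = 0" "?r6 = 0" "?r7 = 0" "?r8 = 0" "?r9
      = 0"
    unfolding pCons_eq_0_iff by blast+
qed

text \<open>
  In the chart \<open>r\<^sub>2\<close> the natural variables are \<open>x\<close>, \<open>y\<close>, \<open>Z = z + x\<close> and \<open>w\<close>. The following five
  functions, together with \<open>k\<close> for \<open>Z\<^sup>2\<close>, are the coefficients of \<open>K\<close> as a polynomial in \<open>x\<close> and \<open>Z\<close>.
\<close>

definition "r2_xx Y v = poly k v - (poly A1 v + Y * poly A2 v + Y\<^sup>2 * poly A3 v)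
  + (poly B4 v + Y * poly B5 v + Y\<^sup>2 * poly B6 v + Y ^ 3 * poly B7 v + Y ^ 4 * poly B8 v)"

definition "r2_xZ Y v = poly A1 v + Y * poly A2 v + Y\<^sup>2 * poly A3 v - 2 * poly k v"

definition "r2_x Y v = a0 * (poly A2 v + Y * poly A3 v) - poly A0 v
  + poly B1 v + Y * poly B2 v + Y\<^sup>2 * poly B3 v
  - a0 * (poly B5 v + 2 * Y * poly B6 v + 2 * Y\<^sup>2 * poly B7 v + 2 * Y ^ 3 * poly B8 v)"

definition "r2_Z Y v = poly A0 v - a0 * (poly A2 v + Y * poly A3 v)"

definition "r2_const Y v = poly B0 v - a0 * (poly B2 v + Y * poly B3 v)
  + a0\<^sup>2 * (poly B6 v + Y * poly B7 v + Y\<^sup>2 * poly B8 v)"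

lemma ev_K_r2:
  "ev K x Y (Z - x) v = r2_xx Y v * x\<^sup>2 + r2_xZ Y v * x * Z + poly k v * Z\<^sup>2
    + r2_x Y v * x + r2_Z Y v * Z + r2_const Y v"
  unfolding normal_form r2_xx_def r2_xZ_def r2_x_def r2_Z_def r2_const_def by algebra

text \<open>
  In the chart \<open>r\<^sub>2\<close> one has \<open>w = 1/p\<close> and \<open>Z = \<alpha>\<^sub>2 p - z p\<^sup>2\<close>. Hence the coefficients of \<open>x\<^sup>2\<close>, \<open>x z\<close>,
  \<open>x\<close>, \<open>z\<close> and \<open>1\<close> in the expression of \<open>K\<close> in this chart are, up to sign and a power \<open>p\<^sup>m\<close>, five
  combinations of the functions above. They are polynomials in \<open>p\<close>; for \<open>K\<close> is quadratic in \<open>x\<close> and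
  \<open>z\<close>, so each of them is a combination of values of the polynomial \<open>K2\<close> at points with
  \<open>x, z \<in> {-1, 0, 1}\<close>. So the degree in \<open>w\<close> of the combination is at most \<open>m\<close>, and this is a system
  of linear equations. In the lemmas below \<open>?Q\<close> is the combination, expanded in powers of \<open>w\<close> and,
  inside, of \<open>y\<^sub>2\<close>; the equations kept are those from which the linear system is solved below.
\<close>

lemma r2_equations_xx:
  shows "B4' 1 - A1' 1 - A2' 0 + B5' 0 + k' 1 = 0" (is "?r10 = 0")
    and "B6' 1 - A3' 1 + 3 * B7' 0 = 0" (is "?r12 = 0")
    and "B7' 1 + 4 * B8' 0 = 0" (is "?r13 = 0")
    and "B5' 2 - A2' 2 - 2 * A3' 1 + 2 * B6' 1 + 3 * B7' 0 = 0" (is "?r21 = 0")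
    and "B6' 2 - A3' 2 + 3 * B7' 1 + 6 * B8' 0 = 0" (is "?r22 = 0")
    and "B4' 3 - A1' 3 - A2' 2 - A3' 1 + B5' 2 + B6' 1 + B7' 0 + k' 3 = 0" (is "?r30 = 0")
    and "B5' 3 - A2' 3 - 2 * A3' 2 + 2 * B6' 2 + 3 * B7' 1 + 4 * B8' 0 = 0" (is "?r31 = 0")
    and "B4' 4 - A1' 4 - A2' 3 - A3' 2 + B5' 3 + B6' 2 + B7' 1 + B8' 0 + k' 4 = 0" (is "?r40 = 0")
proof -
  let ?Q = "[:[:B4' 0 - A1' 0 + k' 0, B5' 0 - A2' 0, B6' 0 - A3' 0, B7' 0, B8' 0:], [:?r10, B5' 1
      - A2' 1 - 2 * A3' 0 + 2 * B6' 0, ?r12, ?r13:], [:B4' 2 - A1' 2 - A2' 1 - A3' 0 + B5' 1 + B6' 0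
      + k' 2, ?r21, ?r22:], [:?r30, ?r31:], [:?r40:]:]"
  have "\<forall>d>0. coeff ?Q d = 0"
  proof (rule degree_le_pole_order_parametric)
    show "polyfun (\<lambda>p. (ev K2 1 y 0 p + ev K2 (- 1) y 0 p - 2 * ev K2 0 y 0 p) * inverse 2)" for y
      by (rule polyfun_if_polyfun2) (intro polyfun2_intros)
  next
    fix y p :: 'a assume p: "p \<noteq> 0"
    define v where "v = 1 / p"
    define Y where "Y = y + v"
    have "poly (poly ?Q [:v:]) y = r2_xx Y v"
      unfolding poly_pCons poly_add poly_mult poly_0 r2_xx_def coefficient_expansions Y_def by algebra
    moreover have "(ev K2 1 y 0 p + ev K2 (- 1) y 0 p - 2 * ev K2 0 y 0 p) * inverse 2
        = p ^ 0 * (r2_xx Y v)"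
      unfolding regular_r2[OF p, symmetric] ev_K_r2 v_def[symmetric] Y_def[symmetric]
      by (simp add: field_simps)
    ultimately show "p ^ 0 * poly (poly ?Q [:1 / p:]) y
        = (ev K2 1 y 0 p + ev K2 (- 1) y 0 p - 2 * ev K2 0 y 0 p) * inverse 2"
      by (simp only: v_def)
  qed
  then show "?r10 = 0" "?r12 = 0" "?r13 = 0" "?r21 = 0" "?r22 = 0" "?r30 = 0" "?r31 = 0" "?r40 = 0"
    unfolding coeffs_above_pCons pCons_eq_0_iff by blast+
qed

lemma r2_equations_xZ:
  shows "A1' 3 + A2' 2 + A3' 1 - 2 * k' 3 = 0" (is "?r30 = 0")
    and "A2' 3 + 2 * A3' 2 = 0" (is "?r31 = 0")
    and "A1' 4 + A2' 3 + A3' 2 - 2 * k' 4 = 0" (is "?r40 = 0")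
proof -
  let ?Q = "[:[:A1' 0 - 2 * k' 0, A2' 0, A3' 0:], [:A1' 1 + A2' 0 - 2 * k' 1, A2' 1 + 2 * A3' 0,
      A3' 1:], [:A1' 2 + A2' 1 + A3' 0 - 2 * k' 2, A2' 2 + 2 * A3' 1, A3' 2:], [:?r30, ?r31:],
      [:?r40:]:]"
  have "\<forall>d>(Suc (Suc 0)). coeff ?Q d = 0"
  proof (rule degree_le_pole_order_parametric)
    show "polyfun (\<lambda>p. ev K2 1 y 0 p + ev K2 0 y 1 p - ev K2 1 y 1 p - ev K2 0 y 0 p)" for y
      by (rule polyfun_if_polyfun2) (intro polyfun2_intros)
  next
    fix y p :: 'a assume p: "p \<noteq> 0"
    define v where "v = 1 / p"
    define Y where "Y = y + v"
    have "poly (poly ?Q [:v:]) y = r2_xZ Y v"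
      unfolding poly_pCons poly_add poly_mult poly_0 r2_xZ_def coefficient_expansions Y_def by algebra
    moreover have "ev K2 1 y 0 p + ev K2 0 y 1 p - ev K2 1 y 1 p - ev K2 0 y 0 p
        = p ^ (Suc (Suc 0)) * (r2_xZ Y v)"
      unfolding regular_r2[OF p, symmetric] ev_K_r2 v_def[symmetric] Y_def[symmetric]
      by (simp add: field_simps)
    ultimately show "p ^ (Suc (Suc 0)) * poly (poly ?Q [:1 / p:]) y
        = ev K2 1 y 0 p + ev K2 0 y 1 p - ev K2 1 y 1 p - ev K2 0 y 0 p"
      by (simp only: v_def)
  qed
  then show "?r30 = 0" "?r31 = 0" "?r40 = 0"
    unfolding coeffs_above_pCons pCons_eq_0_iff by blast+
qed

lemma r2_equations_x:
  shows "a2 * A1' 2 - A0' 1 + a0 * A2' 1 + a2 * A2' 1 + a0 * A3' 0 + a2 * A3' 0 + B1' 1 + B2' 0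
      - a0 * B5' 1 - 2 * a0 * B6' 0 - 2 * a2 * k' 2 = 0" (is "?r20 = 0")
    and "a2 * A2' 2 + a0 * A3' 1 + 2 * a2 * A3' 1 + B2' 1 + 2 * B3' 0 - 2 * a0 * B6' 1
      - 4 * a0 * B7' 0 = 0" (is "?r21 = 0")
    and "a2 * A3' 2 + B3' 1 - 2 * a0 * B7' 1 - 6 * a0 * B8' 0 = 0" (is "?r22 = 0")
    and "a2 * A1' 3 - A0' 2 + a0 * A2' 2 + a2 * A2' 2 + a0 * A3' 1 + a2 * A3' 1 + B1' 2 + B2' 1
      + B3' 0 - a0 * B5' 2 - 2 * a0 * B6' 1 - 2 * a0 * B7' 0 - 2 * a2 * k' 3 = 0" (is "?r30 = 0")
    and "a2 * A2' 3 + a0 * A3' 2 + 2 * a2 * A3' 2 + B2' 2 + 2 * B3' 1 - 2 * a0 * B6' 2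
      - 4 * a0 * B7' 1 - 6 * a0 * B8' 0 = 0" (is "?r31 = 0")
    and "B3' 2 = 0" (is "?r32 = 0")
    and "a2 * A1' 4 - A0' 3 + a0 * A2' 3 + a2 * A2' 3 + a0 * A3' 2 + a2 * A3' 2 + B1' 3 + B2' 2
      + B3' 1 - a0 * B5' 3 - 2 * a0 * B6' 2 - 2 * a0 * B7' 1 - 2 * a0 * B8' 0
      - 2 * a2 * k' 4 = 0" (is "?r40 = 0")
    and "B2' 3 + 2 * B3' 2 = 0" (is "?r41 = 0")
    and "B3' 3 = 0" (is "?r42 = 0")
    and "B2' 4 + 2 * B3' 3 = 0" (is "?r51 = 0")
proof -
  let ?Q = "[:[:a2 * A1' 0 - 2 * a2 * k' 0, a2 * A2' 0, a2 * A3' 0:], [:a2 * A1' 1 - A0' 0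
      + a0 * A2' 0 + a2 * A2' 0 + B1' 0 - a0 * B5' 0 - 2 * a2 * k' 1, a2 * A2' 1 + a0 * A3' 0
      + 2 * a2 * A3' 0 + B2' 0 - 2 * a0 * B6' 0, a2 * A3' 1 + B3' 0 - 2 * a0 * B7' 0,
      - (2 * a0 * B8' 0):], [:?r20, ?r21, ?r22:], [:?r30, ?r31, ?r32:], [:?r40, ?r41, ?r42:],
      [:B1' 4 - A0' 4 + B2' 3 + B3' 2, ?r51:], [:B1' 5 - A0' 5 + B2' 4 + B3' 3:]:]"
  have "\<forall>d>(Suc 0). coeff ?Q d = 0"
  proof (rule degree_le_pole_order_parametric)
    show "polyfun (\<lambda>p. (ev K2 1 y 0 p - ev K2 (- 1) y 0 p) * inverse 2)" for y
      by (rule polyfun_if_polyfun2) (intro polyfun2_intros)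
  next
    fix y p :: 'a assume p: "p \<noteq> 0"
    define v where "v = 1 / p"
    have pv: "p * v = 1" using p by (simp add: v_def)
    define Y where "Y = y + v"
    have "poly (poly ?Q [:v:]) y = a2 * r2_xZ Y v + v * r2_x Y v"
      unfolding poly_pCons poly_add poly_mult poly_0 r2_xZ_def r2_x_def coefficient_expansions Y_def
          by algebra
    moreover have "(ev K2 1 y 0 p - ev K2 (- 1) y 0 p) * inverse 2
        = p ^ (Suc 0) * (a2 * r2_xZ Y v + v * r2_x Y v)"
      unfolding regular_r2[OF p, symmetric] ev_K_r2 v_def[symmetric] Y_def[symmetric]
      using pv by (simp add: field_simps)
    ultimately show "p ^ (Suc 0) * poly (poly ?Q [:1 / p:]) y
        = (ev K2 1 y 0 p - ev K2 (- 1) y 0 p) * inverse 2"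
      by (simp only: v_def)
  qed
  then show "?r20 = 0" "?r21 = 0" "?r22 = 0" "?r30 = 0" "?r31 = 0" "?r32 = 0" "?r40 = 0" "?r41 = 0" "?r42
      = 0" "?r51 = 0"
    unfolding coeffs_above_pCons pCons_eq_0_iff by blast+
qed

lemma r2_equations_Z:
  shows "A0' 4 = 0" (is "?r50 = 0")
    and "A0' 5 = 0" (is "?r60 = 0")
proof -
  let ?Q = "[:[:2 * a2 * k' 0:], [:A0' 0 - a0 * A2' 0 + 2 * a2 * k' 1, - (a0 * A3' 0):], [:A0' 1
      - a0 * A2' 1 - a0 * A3' 0 + 2 * a2 * k' 2, - (a0 * A3' 1):], [:A0' 2 - a0 * A2' 2 - a0 * A3' 1
      + 2 * a2 * k' 3, - (a0 * A3' 2):], [:A0' 3 - a0 * A2' 3 - a0 * A3' 2 + 2 * a2 * k' 4:],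
      [:?r50:], [:?r60:]:]"
  have "\<forall>d>(Suc (Suc (Suc 0))). coeff ?Q d = 0"
  proof (rule degree_le_pole_order_parametric)
    show "polyfun (\<lambda>p. (ev K2 0 y (- 1) p - ev K2 0 y 1 p) * inverse 2)" for y
      by (rule polyfun_if_polyfun2) (intro polyfun2_intros)
  next
    fix y p :: 'a assume p: "p \<noteq> 0"
    define v where "v = 1 / p"
    have pv: "p * v = 1" using p by (simp add: v_def)
    define Y where "Y = y + v"
    have "poly (poly ?Q [:v:]) y = 2 * a2 * poly k v + v * r2_Z Y v"
      unfolding poly_pCons poly_add poly_mult poly_0 r2_Z_def coefficient_expansions Y_def by algebra
    moreover have "(ev K2 0 y (- 1) p - ev K2 0 y 1 p) * inverse 2
        = p ^ (Suc (Suc (Suc 0))) * (2 * a2 * poly k v + v * r2_Z Y v)"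
      unfolding regular_r2[OF p, symmetric] ev_K_r2 v_def[symmetric] Y_def[symmetric]
      using pv by (simp add: field_simps) algebra
    ultimately show "p ^ (Suc (Suc (Suc 0))) * poly (poly ?Q [:1 / p:]) y
        = (ev K2 0 y (- 1) p - ev K2 0 y 1 p) * inverse 2"
      by (simp only: v_def)
  qed
  then show "?r50 = 0" "?r60 = 0"
    unfolding coeffs_above_pCons pCons_eq_0_iff by blast+
qed

lemma r2_equations_const:
  shows "a2 * A0' 2 - a0 * a2 * A2' 2 - a0 * a2 * A3' 1 + B0' 1 - a0 * B2' 1 - a0 * B3' 0
      + a0\<^sup>2 * B6' 1 + a0\<^sup>2 * B7' 0 + a2\<^sup>2 * k' 3 = 0" (is "?r30 = 0")
    and "a2 * A0' 3 - a0 * a2 * A2' 3 - a0 * a2 * A3' 2 + B0' 2 - a0 * B2' 2 - a0 * B3' 1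
      + a0\<^sup>2 * B6' 2 + a0\<^sup>2 * B7' 1 + a0\<^sup>2 * B8' 0
      + a2\<^sup>2 * k' 4 = 0" (is "?r40 = 0")
    and "a2 * A0' 4 + B0' 3 - a0 * B2' 3 - a0 * B3' 2 = 0" (is "?r50 = 0")
    and "a2 * A0' 5 + B0' 4 - a0 * B2' 4 - a0 * B3' 3 = 0" (is "?r60 = 0")
    and "B0' 5 = 0" (is "?r70 = 0")
    and "B0' 6 = 0" (is "?r80 = 0")
proof -
  let ?Q = "[:[:a2\<^sup>2 * k' 0:], [:a2 * A0' 0 - a0 * a2 * A2' 0 + a2\<^sup>2 * k' 1,
      - (a0 * a2 * A3' 0):], [:a2 * A0' 1 - a0 * a2 * A2' 1 - a0 * a2 * A3' 0 + B0' 0 - a0 * B2' 0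
      + a0\<^sup>2 * B6' 0 + a2\<^sup>2 * k' 2, a0\<^sup>2 * B7' 0 - a0 * a2 * A3' 1 - a0 * B3' 0,
      a0\<^sup>2 * B8' 0:], [:?r30, a0\<^sup>2 * B7' 1 - a0 * a2 * A3' 2 - a0 * B3' 1
      + 2 * a0\<^sup>2 * B8' 0:], [:?r40, - (a0 * B3' 2):], [:?r50, - (a0 * B3' 3):], [:?r60:],
      [:?r70:], [:?r80:]:]"
  have "\<forall>d>(Suc (Suc 0)). coeff ?Q d = 0"
  proof (rule degree_le_pole_order_parametric)
    show "polyfun (\<lambda>p. ev K2 0 y 0 p)" for y
      by (rule polyfun_if_polyfun2) (intro polyfun2_intros)
  next
    fix y p :: 'a assume p: "p \<noteq> 0"
    define v where "v = 1 / p"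
    have pv: "p * v = 1" using p by (simp add: v_def)
    define Y where "Y = y + v"
    have "poly (poly ?Q [:v:]) y = a2\<^sup>2 * poly k v + a2 * v * r2_Z Y v + v\<^sup>2 * r2_const Y v"
      unfolding poly_pCons poly_add poly_mult poly_0 r2_Z_def r2_const_def coefficient_expansions Y_def
          by algebra
    moreover have "ev K2 0 y 0 p
        = p ^ (Suc (Suc 0)) * (a2\<^sup>2 * poly k v + a2 * v * r2_Z Y v + v\<^sup>2 * r2_const Y v)"
      unfolding regular_r2[OF p, symmetric] ev_K_r2 v_def[symmetric] Y_def[symmetric]
      using pv by (simp add: field_simps) algebra
    ultimately show "p ^ (Suc (Suc 0)) * poly (poly ?Q [:1 / p:]) y
        = ev K2 0 y 0 p"
      by (simp only: v_def)
  qed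
  then show "?r30 = 0" "?r40 = 0" "?r50 = 0" "?r60 = 0" "?r70 = 0" "?r80 = 0"
    unfolding coeffs_above_pCons pCons_eq_0_iff by blast+
qed

end

section \<open>Solution of the linear system\<close>

context quadratic_hamiltonian
begin

text \<open>
  The system is triangular with respect to the degree in \<open>x, z\<close>. The coefficients of degree 2,
  those of \<open>k\<close>, \<open>A1\<close>, \<open>A2\<close>, \<open>A3\<close>, \<open>B4\<close>, \<dots>, \<open>B8\<close>, satisfy homogeneous equations among themselves
  whose solution space is spanned by one vector. The coefficients of \<open>A0\<close>, \<open>B1\<close>, \<open>B2\<close>, \<open>B3\<close> and
  then those of \<open>B0\<close> are linear functions of them, except \<open>B0' 0\<close>, which is free. Here \<open>q\<close>
  parametrizes the solutions, scaled so that \<open>q\<close> times the numerator of \<open>H\<close> is the solution. One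
  equation, the coefficient of \<open>w\<^sup>0\<close> in the third identity in \<open>r\<^sub>1\<close>, remains and determines \<open>q\<close>. A
  fact with a primed name gives the final value of a coefficient that was first expressed by other
  unknowns.
\<close>

lemma K_determined:
  assumes a: "a0 + 2 * a1 + a2 = 1"
  shows "(64 * t ^ 3 + 27) * (ev K x y z w - ev K 0 0 0 0) = H_numerator t a0 a1 a2 x y z w"
proof -
  define q where "q = B4' 0 / 24"
  have q: "B4' 0 = 24 * q" by (simp add: q_def)
  have B4_3: "B4' 3 = 0"
    using r1_equations_const(10) by (simp del: One_nat_def)
  have B4_4: "B4' 4 = 0"
    using r1_equations_const(11) by (simp del: One_nat_def)
  have A1_3: "A1' 3 = 0"
    using r1_equations_z(8) by (simp del: One_nat_def)
  have A1_4: "A1' 4 = 0"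
    using r1_equations_z(9) by (simp del: One_nat_def)
  have B4_2: "B4' 2 = 0"
    using r1_equations_const(9) B4_4 by (simp del: One_nat_def)
  have A1_2: "A1' 2 = 0"
    using r1_equations_z(7) A1_4 by (simp del: One_nat_def)
  have B7_1: "B7' 1 = - (4 * B8' 0)"
    using r2_equations_xx(3) by algebra
  have A2_3: "A2' 3 = - (2 * A3' 2)"
    using r2_equations_xZ(2) by algebra
  have B4_1: "B4' 1 = B5' 3"
    using r1_equations_const(8) B4_3 A1_4 by algebra
  have A3_2: "A3' 2 = - (2 * k' 4)"
    using r2_equations_xZ(3) A2_3 A1_4 by algebra
  have A1_1: "A1' 1 = 8 * k' 4"
    using r1_equations_z(6) A2_3 A3_2 A1_3 by algebra
  have B5_2: "B5' 2 = B4' 0"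
    using r1_equations_const(7) B4_4 B4_2 A1_3 by (simp del: One_nat_def)
  have B5_1: "B5' 1 = - (t * B5' 3)"
    using r1_equations_const(6) B4_3 B4_1 A1_4 A1_2 by algebra
  have A3_0: "A3' 0 = - (t\<^sup>2 * A1' 0) - t * A2' 0"
    using r1_equations_z(1) by algebra
  have A3_1: "A3' 1 = B6' 1 + 3 * B7' 0"
    using r2_equations_xx(2) by algebra
  have B6_2: "B6' 2 = 6 * B8' 0 - 2 * k' 4"
    using r2_equations_xx(5) B7_1 A3_2 by algebra
  have A2_1: "A2' 1 = - (4 * k' 2) - 12 * t * k' 4"
    using r1_equations_z(4) A2_3 A3_2 A1_3 A1_1 by algebra
  have A1_0: "A1' 0 = A2' 2 + 4 * k' 3"
    using r1_equations_z(5) A1_4 A1_2 by algebra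
  have B6_1: "B6' 1 = 4 * k' 3"
    using r1_equations_const(4) B5_1 B4_3 B4_1 A1_4 A1_2 A1_0 by algebra
  have A2_2: "A2' 2 = - (3 * B7' 0) - 2 * k' 3"
    using r2_equations_xZ(1) A3_1 B6_1 A1_3 by algebra
  have k_3: "2 * k' 3 = - (B4' 0)"
    using r2_equations_xx(4) B6_1 B5_2 A3_1 A2_2 by algebra
  have B7_0: "2 * B7' 0 = B4' 0"
    using r2_equations_xx(6) k_3 B6_1 B5_2 B4_3 A3_1 A2_2 A1_3 by algebra
  have B5_3: "B5' 3 = 4 * k' 4 - 4 * B8' 0"
    using r2_equations_xx(7) B7_1 B6_2 A3_2 A2_3 by algebra
  have k_4: "k' 4 = B8' 0"
    using r2_equations_xx(8) B7_1 B6_2 B5_3 B4_4 A3_2 A2_3 A1_4 by (simp del: One_nat_def)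
  have B5_0: "B5' 0 = - (t * B4' 0)"
    using r1_equations_const(5) k_4 B6_2 B5_2 B4_4 B4_2 A2_3 A3_2 A1_3 A1_1 by algebra
  have B8_0: "2 * B8' 0 = - (t * B4' 0) - 2 * t\<^sup>2 * B6' 0"
    using r1_equations_const(1) B7_0 B5_0 by algebra
  have k_2: "4 * k' 2 = 4 * t\<^sup>2 * B4' 0 + 8 * t ^ 3 * B6' 0 + B6' 0"
    using r1_equations_const(3) B6_2 k_4 B8_0 B5_2 B5_0 B4_4 B4_2 A2_3 A3_2 A2_1 A1_3 A1_1 by algebra
  have k_0: "8 * k' 0 = - (4 * t ^ 3 * B4' 0) - B4' 0 - 8 * t ^ 4 * B6' 0"
    using r1_equations_const(2) B7_0 B6_2 k_4 B8_0 B5_2 B5_0 B4_2 A3_1 B6_1 k_3 A2_1 k_2 A1_1 by algebra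
  have k_1: "k' 1 = A2' 0 - 3 * t * B4' 0 - 8 * t\<^sup>2 * B6' 0"
    using r2_equations_xx(1) B5_0 B4_1 B5_3 k_4 B8_0 A1_1 by algebra
  have A2_0: "10 * A2' 0 = 35 * t * B4' 0 + 68 * t\<^sup>2 * B6' 0"
    using r1_equations_z(3) k_1 A3_2 k_4 B8_0 A2_2 B7_0 k_3 A1_2 A1_0 by algebra
  have "t * B6' 0 = 0"
    using r1_equations_z(2) k_0 A3_1 B7_0 B6_1 k_3 A2_1 k_4 B8_0 k_2 A1_1 by algebra
  then have B6_0: "B6' 0 = 0"
    using t_nonzero by simp
  have A2_0': "A2' 0 = 84 * t * q"
    using A2_0 q B6_0 by algebra
  have k_1': "k' 1 = 12 * t * q"
    using k_1 A2_0' q B6_0 by algebra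
  have k_0': "k' 0 = - (12 * t ^ 3 * q) - 3 * q"
    using k_0 q B6_0 by algebra
  have k_2': "k' 2 = 24 * t\<^sup>2 * q"
    using k_2 B6_0 q by algebra
  have B8_0': "B8' 0 = - (12 * t * q)"
    using B8_0 q B6_0 by algebra
  have B5_0': "B5' 0 = - (24 * t * q)"
    using B5_0 q by algebra
  have k_4': "k' 4 = - (12 * t * q)"
    using k_4 B8_0' by (simp del: One_nat_def)
  have B5_3': "B5' 3 = 0"
    using B5_3 B8_0' k_4' by (simp del: One_nat_def)
  have B7_0': "B7' 0 = 12 * q"
    using B7_0 q by algebra
  have k_3': "k' 3 = - (12 * q)"
    using k_3 q by algebra
  have A2_2': "A2' 2 = - (12 * q)"
    using A2_2 k_3' B7_0' by algebra
  have B6_1': "B6' 1 = - (48 * q)"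
    using B6_1 k_3' by algebra
  have A1_0': "A1' 0 = - (60 * q)"
    using A1_0 k_3' A2_2' by algebra
  have A2_1': "A2' 1 = 48 * t\<^sup>2 * q"
    using A2_1 k_2' k_4' by algebra
  have B6_2': "B6' 2 = - (48 * t * q)"
    using B6_2 B8_0' k_4' by algebra
  have A3_1': "A3' 1 = - (12 * q)"
    using A3_1 B6_1' B7_0' by algebra
  have A3_0': "A3' 0 = - (24 * t\<^sup>2 * q)"
    using A3_0 A1_0' A2_0' by algebra
  have B5_1': "B5' 1 = 0"
    using B5_1 B5_3' by (simp del: One_nat_def)
  have B5_2': "B5' 2 = 24 * q"
    using B5_2 q by (simp del: One_nat_def)
  have A1_1': "A1' 1 = - (96 * t * q)"
    using A1_1 k_4' by algebra
  have A3_2': "A3' 2 = 24 * t * q"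
    using A3_2 k_4' by algebra
  have B4_1': "B4' 1 = 0"
    using B4_1 B5_3' by (simp del: One_nat_def)
  have A2_3': "A2' 3 = - (48 * t * q)"
    using A2_3 A3_2' by algebra
  have B7_1': "B7' 1 = 48 * t * q"
    using B7_1 B8_0' by algebra
  have B3_2: "B3' 2 = 0"
    using r2_equations_x(6) by (simp del: One_nat_def)
  have B3_3: "B3' 3 = 0"
    using r2_equations_x(9) by (simp del: One_nat_def)
  have A0_4: "A0' 4 = 0"
    using r2_equations_Z(1) by (simp del: One_nat_def)
  have A0_5: "A0' 5 = 0"
    using r2_equations_Z(2) by (simp del: One_nat_def)
  have B1_5: "B1' 5 = 0"
    using r1_equations_linear(10) B4_3 by (simp del: One_nat_def)
  have B2_3: "B2' 3 = 0"
    using r2_equations_x(8) B3_2 by (simp del: One_nat_def)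
  have B2_4: "B2' 4 = 0"
    using r2_equations_x(10) B3_3 by (simp del: One_nat_def)
  have B1_4: "B1' 4 = 0"
    using r1_equations_linear(9) B4_4 B4_2 by (simp del: One_nat_def)
  have B1_3: "B1' 3 = 0"
    using r1_equations_linear(8) B5_3' B4_3 B4_1' B1_5 A1_4 by (simp del: One_nat_def)
  have B1_1: "B1' 1 = 0"
    using r1_equations_linear(6) B5_3' B5_1' B4_3 B4_1' B2_3 B1_5 B1_3 A1_4 A1_2 A0_4
        by (simp del: One_nat_def)
  have B2_2: "B2' 2 = - (2 * B3' 1)"
    using r2_equations_x(5) B8_0' B7_1' B6_2' A3_2' A2_3' by algebra
  have A0_3: "A0' 3 = - (B3' 1)"
    using r2_equations_x(7) k_4' B8_0' B7_1' B6_2' B5_3' B2_2 B1_3 A3_2' A2_3' A1_4 by algebra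
  have B3_1: "B3' 1 = 24 * t * a0 * q - 24 * t * a2 * q"
    using r2_equations_x(3) B8_0' B7_1' A3_2' by algebra
  have B1_2: "B1' 2 = 24 * a0 * q + 24 * a1 * q"
    using r1_equations_linear(7) B5_2' B4_4 B4_2 q B2_4 B1_4 A1_3 A0_5 by algebra
  have B1_0: "B1' 0 = 72 * t * a0 * q + 168 * t * a1 * q + 96 * t * a2 * q"
    using r1_equations_linear(5) B6_2' B5_2' B5_0' B4_4 B4_2 q B2_4 B2_2 B3_1 B1_4 B1_2 A2_3' A1_3 A1_1'
      A0_3 by algebra
  have B2_1: "B2' 1 = 36 * a2 * q - 2 * B3' 0 - 36 * a0 * q"
    using r2_equations_x(2) B7_0' B6_1' A3_1' A2_2' by algebra
  have A0_1: "A0' 1 = B2' 0 + 24 * t\<^sup>2 * a0 * q - 24 * t\<^sup>2 * a2 * q"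
    using r2_equations_x(1) k_2' B6_0 B5_1' B1_1 A3_0' A2_1' A1_2 by algebra
  have B2_0: "B2' 0 = - (32 * t\<^sup>2 * a0 * q) - 64 * t\<^sup>2 * a1 * q - 32 * t\<^sup>2 * a2 * q"
    using r1_equations_linear(3) B6_2' B6_0 B5_2' B5_0' B4_2 q B3_2 B2_2 B3_1 B1_2 B1_0 A2_1' A1_1' A0_1
      by algebra
  have A0_0: "A0' 0 = 54 * t * a0 * q - t * B3' 0 + 12 * t * a1 * q + 6 * t * a2 * q"
    using r1_equations_linear(2) B7_1' B6_1' B5_1' B4_1' B3_1 B2_1 B1_1 A2_0' A1_0' by algebra
  have A0_2: "A0' 2 = 12 * a0 * q - B3' 0 + 24 * a1 * q + 36 * a2 * q"
    using r2_equations_x(4) k_3' B7_0' B6_1' B5_2' B2_1 B1_2 A3_1' A2_2' A1_3 by algebra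
  have B3_0: "B3' 0 = 27 * a0 * q + 42 * a1 * q + 27 * a2 * q"
    using r1_equations_linear(4) B6_1' B5_3' B5_1' B4_3 B4_1' B3_3 B2_3 B2_1 B1_3 B1_1 A2_2' A1_2 A1_0'
      A0_2 by algebra
  have A0_2': "A0' 2 = 9 * a2 * q - 15 * a0 * q - 18 * a1 * q"
    using A0_2 B3_0 by algebra
  have A0_0': "A0' 0 = 27 * t * a0 * q - 30 * t * a1 * q - 21 * t * a2 * q"
    using A0_0 B3_0 by algebra
  have A0_1': "A0' 1 = - (8 * t\<^sup>2 * a0 * q) - 64 * t\<^sup>2 * a1 * q - 56 * t\<^sup>2 * a2 * q"
    using A0_1 B2_0 by algebra
  have B2_1': "B2' 1 = - (90 * a0 * q) - 84 * a1 * q - 18 * a2 * q"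
    using B2_1 B3_0 by algebra
  have A0_3': "A0' 3 = 24 * t * a2 * q - 24 * t * a0 * q"
    using A0_3 B3_1 by algebra
  have B2_2': "B2' 2 = 48 * t * a2 * q - 48 * t * a0 * q"
    using B2_2 B3_1 by algebra
  have B0_5: "B0' 5 = 0"
    using r2_equations_const(5) by (simp del: One_nat_def)
  have B0_6: "B0' 6 = 0"
    using r2_equations_const(6) by (simp del: One_nat_def)
  have B0_3: "B0' 3 = 0"
    using r2_equations_const(3) B3_2 B2_3 A0_4 by (simp del: One_nat_def)
  have B0_4: "B0' 4 = 0"
    using r2_equations_const(4) B3_3 B2_4 A0_5 by (simp del: One_nat_def)
  have B0_2: "B0' 2 = 24 * t * a0 * a2 * q - 12 * t * a0\<^sup>2 * q - 12 * t * a2\<^sup>2 * q"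
    using r2_equations_const(2) k_4' B8_0' B7_1' B6_2' B3_1 B2_2' A3_2' A2_3' A0_3' by algebra
  have B0_1: "B0' 1 = 18 * a1 * a2 * q - 27 * a0\<^sup>2 * q - 42 * a0 * a1 * q + 3 * a2\<^sup>2 * q"
    using r2_equations_const(1) k_3' B7_0' B6_1' B3_0 B2_1' A3_1' A2_2' A0_2' by algebra
  have "q * (64 * t ^ 3 + 27) * (a0 + 2 * a1 + a2) = 1"
    using r1_equations_linear(1) B1_0 B2_0 B3_0 q B5_0' B6_0 B7_0' by algebra
  then have norm: "(64 * t ^ 3 + 27) * q = 1" unfolding a by (simp add: mult.commute)
  \<comment> \<open>The numerator of \<open>H\<close> and the solution agree only modulo the normalization of the parameters.\<close>
  have a': "a2 = 1 - a0 - 2 * a1" using a by algebra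
  have K0: "ev K 0 0 0 0 = B0' 0 - a0 * B2' 0"
    unfolding normal_form coefficient_expansions B6_0 by (simp del: One_nat_def)
  have "ev K x y z w - ev K 0 0 0 0 = q * H_numerator t a0 a1 a2 x y z w"
    unfolding K0 unfolding normal_form coefficient_expansions H_numerator_def a'
      A0_0' A0_1' A0_2' A0_3' A0_4 A0_5 A1_0' A1_1' A1_2 A1_3 A1_4 A2_0' A2_1' A2_2' A2_3' A3_0'
      A3_1' A3_2' B0_1 B0_2 B0_3 B0_4 B0_5 B0_6 B1_0 B1_1 B1_2 B1_3 B1_4 B1_5 B2_0 B2_1' B2_2'
      B2_3 B2_4 B3_0 B3_1 B3_2 B3_3 q B4_1' B4_2 B4_3 B4_4 B5_0' B5_1' B5_2' B5_3' B6_0 B6_1'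
      B6_2' B7_0' B7_1' B8_0' k_0' k_1' k_2' k_3' k_4'
    unfolding mult_zero_left mult_zero_right add_0_left add_0_right by algebra
  then show ?thesis using norm by (simp add: mult.assoc[symmetric])
qed

end

section \<open>Hamiltonian systems over the rational functions\<close>

lemma hamiltonian_system_add_const: "hamiltonian_system (p + const4 c) = hamiltonian_system p"
  for c :: "'a::field"
proof -
  have m: "map_poly f (p + [:c:]) = map_poly f p" if "f 0 = 0" "\<And>q. f (q + c) = f q"
    for f :: "'b::comm_monoid_add \<Rightarrow> 'c::comm_monoid_add" and p :: "'b poly" and c
    by (rule poly_eqI) (use that(2)[of 0] that in \<open>auto simp: coeff_map_poly coeff_pCons split: nat.splits\<close>)
  show ?thesis
    by (simp add: hamiltonian_system_def partial_x_def partial_y_def partial_z_def partial_w_def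
        const4_def pderiv_add m pderiv_pCons)
qed

theorem theorem5p3:
  fixes \<alpha>0 \<alpha>1 \<alpha>2 :: complex
    and K K0 :: "complex poly fract poly4"
  assumes "\<alpha>0 + 2 * \<alpha>1 + \<alpha>2 = 1"
    and "total_degree K = 6"
    and "expressed_in (r0 \<alpha>0) K K0"
    and "\<exists>K2. expressed_in (r2 \<alpha>2) K K2"
    and "\<exists>K1. expressed_in (r1 \<alpha>1) (K0 + var_x) K1"
  shows "hamiltonian_system K = hamiltonian_system (H \<alpha>0 \<alpha>1 \<alpha>2)"
proof -
  let ?a0 = "ct_const \<alpha>0" and ?a1 = "ct_const \<alpha>1" and ?a2 = "ct_const \<alpha>2"
  obtain K2 where K2: "expressed_in (r2 \<alpha>2) K K2" using assms(4) by blast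
  obtain K1 where K1: "expressed_in (r1 \<alpha>1) (K0 + var_x) K1" using assms(5) by blast
  have t: "ct_t \<noteq> 0" by (simp add: ct_t_def)
  \<comment> \<open>The element \<open>t\<close> of \<open>\<complex>(t)\<close> is transcendental, so it is no root of \<open>64 t\<^sup>3 + 27\<close>.\<close>
  have disc: "64 * ct_t ^ 3 + 27 \<noteq> 0"
  proof -
    have "64 * ct_t ^ 3 + 27 = to_fract (64 * [:0, 1:] ^ 3 + 27)"
      by (simp only: ct_t_def to_fract_add to_fract_mult to_fract_numeral power3_eq_cube)
    moreover have "poly (64 * [:0, 1:] ^ 3 + 27) (0 :: complex) \<noteq> 0" by simp
    then have "(64 * [:0, 1:] ^ 3 + 27 :: complex poly) \<noteq> 0" by (metis poly_0)
    ultimately show ?thesis by (simp only: to_fract_eq_0_iff not_False_eq_True)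
  qed
  have sum: "?a0 + 2 * ?a1 + ?a2 = 1"
  proof -
    have "?a0 + 2 * ?a1 + ?a2 = to_fract [:\<alpha>0 + 2 * \<alpha>1 + \<alpha>2:]"
      unfolding ct_const_def mult_2 to_fract_add[symmetric] by simp
    also have "\<dots> = 1" unfolding assms(1) by (simp add: pCons_one)
    finally show ?thesis .
  qed
  interpret regular_hamiltonian ct_t ?a0 ?a1 ?a2 K K0 K1 K2
  proof
    show "coeff4 K i j k l = 0" if "6 < i + j + k + l" for i j k l
      using coeff4_eq_0_if_total_degree_less[of K] that assms(2) by simp
    show "ev K ((?a0 - x * y) * y) (1 / y) z w = ev K0 x y z w" if "y \<noteq> 0" for x y z w
      by (rule expressed_in_r0[OF _ that]) (use assms(3) in \<open>simp add: r0_def\<close>)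
    show "ev K0 (1 / x) (ct_t - w\<^sup>2 - (x * y + ?a1) * x) (z + 2 * w / x) w + 1 / x = ev K1 x y z w"
      if "x \<noteq> 0" for x y z w
      using expressed_in_r1[of ct_t ?a1 "K0 + var_x" K1 x w y z] K1 that by (simp add: r1_def)
    show "ev K x (y + 1 / w) ((?a2 - z * w) * w - x) (1 / w) = ev K2 x y z w" if "w \<noteq> 0" for x y z w
      by (rule expressed_in_r2[OF _ that]) (use K2 in \<open>simp add: r2_def\<close>)
  qed (rule t)
  obtain k A0 A1 A2 A3 B0 B1 B2 B3 B4 B5 B6 B7 B8 where
    "quadratic_hamiltonian ct_t ?a0 ?a1 ?a2 K K0 K1 K2 k A0 A1 A2 A3 B0 B1 B2 B3 B4 B5 B6 B7 B8"
    using K_normal_form by blast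
  then interpret quadratic_hamiltonian ct_t ?a0 ?a1 ?a2 K K0 K1 K2
    k A0 A1 A2 A3 B0 B1 B2 B3 B4 B5 B6 B7 B8 .
  have "K = H \<alpha>0 \<alpha>1 \<alpha>2 + const4 (ev K 0 0 0 0)"
  proof (rule ev_eqI)
    fix x y z w
    have "ev (H \<alpha>0 \<alpha>1 \<alpha>2) x y z w = 1 / (64 * ct_t ^ 3 + 27) * H_numerator ct_t ?a0 ?a1 ?a2 x y z w"
    proof -
      have "(4 * ct_t + 3) * (16 * ct_t\<^sup>2 - 12 * ct_t + 9) = 64 * ct_t ^ 3 + 27" by algebra
      then show ?thesis unfolding H_def H_numerator_def by (simp only: ev_simps)
    qed
    also have "\<dots> = ev K x y z w - ev K 0 0 0 0"
      using K_determined[OF sum, of x y z w] disc by (simp add: field_simps)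
    finally show "ev K x y z w = ev (H \<alpha>0 \<alpha>1 \<alpha>2 + const4 (ev K 0 0 0 0)) x y z w" by simp
  qed
  then show ?thesis by (metis hamiltonian_system_add_const)
qed

end
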